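(* For all integers $n\geq 0$, \begin{align*} \overline{R^\ast_8}(16n+9)&\equiv 0 \pmod{8}, & \overline{R^\ast_8}(16n+11)&\equiv 0 \pmod{16},\\ \overline{R^\ast_8}(32n+25)&\equiv 0 \pmod{16}, & \overline{R^\ast_8}(64n+37)&\equiv 0 \pmod{32},\\ \overline{R^\ast_8}(16n+13)&\equiv 0 \pmod{64}, & \overline{R^\ast_8}(32n+21)&\equiv 0 \pmod{64},\\ \overline{R^\ast_8}(16n+15)&\equiv 0 \pmod{128}, & \overline{R^\ast_8}(32n+29)&\equiv 0 \pmod{256},\\ \overline{R^\ast_8}(128n+85)&\equiv 0 \pmod{512}, & \overline{R^\ast_8}(64n+53)&\equiv 0 \pmod{1024},\\ \overline{R^\ast_8}(128n+117)&\equiv 0 \pmod{4096}. \end{align*}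
   Context: An overpartition of $n$ is a partition of $n$ in which the first occurrence of each part size may optionally be overlined. For a positive integer $\ell$, $\overline{R_\ell^\ast}(n)$ denotes the number of overpartitions of $n$ in which no non-overlined part is divisible by $\ell$. Equivalently, with $f_k:=\prod_{i\geq 1}(1-q^{ki})$, one has $\sum_{n\geq 0}\overline{R_\ell^\ast}(n)q^n = \frac{f_2 f_\ell}{f_1^2}$. *)

theory Defs
  imports "HOL-Library.Multiset" "HOL-Number_Theory.Cong"
begin

text \<open>
  An overpartition is a pair \<open>(M, S)\<close>: \<open>M\<close> is the multiset of parts, and \<open>S\<close> is the set of
  part sizes whose first occurrence is overlined.  The multiset of non-overlined parts is
  therefore \<open>M - mset_set S\<close>.
\<close>

definition overpartitions :: "nat \<Rightarrow> (nat multiset \<times> nat set) set" where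
  "overpartitions n =
     {(M, S). (\<forall>k \<in># M. k > 0) \<and> sum_mset M = n \<and> S \<subseteq> set_mset M}"

definition non_overlined_parts :: "nat multiset \<times> nat set \<Rightarrow> nat multiset" where
  "non_overlined_parts P = fst P - mset_set (snd P)"

definition R_star :: "nat \<Rightarrow> nat \<Rightarrow> nat" where
  "R_star l n =
     card {P \<in> overpartitions n. \<forall>k \<in># non_overlined_parts P. \<not> l dvd k}"

lemma finite_overpartitions: "finite (overpartitions n)"
proof -
  have size_le: "size M \<le> sum_mset M" if "\<forall>k \<in># M. k > 0" for M :: "nat multiset"
    using that by (induction M) auto
  have elem_le: "k \<le> sum_mset M" if "k \<in># M" for k and M :: "nat multiset"
    using that by (metis le_add1 insert_DiffM sum_mset.add_mset)
  have "overpartitions n \<subseteq> (mset ` {xs. set xs \<subseteq> {..n} \<and> length xs \<le> n}) \<times> Pow {..n}"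
  proof
    fix P assume P: "P \<in> overpartitions n"
    obtain M S where MS: "P = (M, S)" by fastforce
    obtain xs where xs: "mset xs = M" using ex_mset by blast
    have "\<forall>k \<in># M. k > 0" "sum_mset M = n" "S \<subseteq> set_mset M"
      using P by (auto simp: MS overpartitions_def)
    then have "length xs \<le> n" "set xs \<subseteq> {..n}" "S \<subseteq> {..n}"
      using size_le[of M] elem_le[of _ M] xs by auto
    then show "P \<in> (mset ` {xs. set xs \<subseteq> {..n} \<and> length xs \<le> n}) \<times> Pow {..n}"
      using MS xs by auto
  qed
  moreover have "finite (mset ` {xs. set xs \<subseteq> {..n} \<and> length xs \<le> n} \<times> Pow {..n})"
    by (intro finite_cartesian_product finite_imageI finite_lists_length_le) auto
  ultimately show ?thesis by (rule finite_subset)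
qed

end

theory Submission
  imports Defs "HOL-Computational_Algebra.Formal_Power_Series"
begin

text \<open>
  Write \<open>\<phi>(q) = \<Sum> q^(x^2)\<close> (over all integers \<open>x\<close>) and \<open>\<psi>(q) = \<Sum> q^(k(k+1)/2)\<close> (over \<open>k \<ge> 0\<close>).
  Gauss's identity \<open>\<phi>(-q) = f_1^2/f_2\<close> turns the generating function into \<open>f_8/\<phi>(-q)\<close>, and
  \<open>1/\<phi>(-q) = \<phi>(q) \<phi>(q^2)^2 \<phi>(q^4)^4/\<phi>(-q^8)^8\<close>.  The dissections
  \<open>\<phi>(q) = \<phi>(q^4) + 2q\<psi>(q^8)\<close> and \<open>\<phi>(q)^2 = \<phi>(q^2)^2 + 4q\<psi>(q^4)^2\<close> then give every subseries
  needed as an exact expression in \<open>\<phi>\<close>, \<open>\<psi>\<close>, \<open>f_1\<close>; at each step \<open>f_1\<psi>(q) = f_2^2\<close> absorbs the factor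
  \<open>\<psi>\<close> produced by the odd part.  Finally \<open>\<phi>(\<plusminus>q)\<close>, \<open>\<phi>(\<plusminus>q)^2\<close>, \<open>\<phi>(\<plusminus>q)^4\<close>, and hence \<open>f_1^2\<close>, \<open>f_1^4\<close>,
  \<open>f_1^8\<close>, are even functions of \<open>q\<close> modulo 2, 4, 8, so that an odd part gains a further factor 2, 4 or 8.
\<close>

section \<open>Dilation and dissection of power series\<close>

unbundle fps_syntax

abbreviation X :: "int fps" where "X \<equiv> fps_X"

text \<open>The substitution of \<open>q^2\<close> for \<open>q\<close>. The arguments
  \<open>q^4\<close> and \<open>q^8\<close> are written by nesting it, so that each dissection
  strips one level.\<close>

definition dil :: "int fps \<Rightarrow> int fps" where
  "dil f = f oo X ^ 2"

lemma dil_nth: "dil f $ n = (if even n then f $ (n div 2) else 0)"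
proof -
  have "dil f $ n = (\<Sum>i\<in>{0..n}. if n = 2 * i then f $ i else 0)"
    unfolding dil_def fps_compose_nth power_mult[symmetric] fps_X_power_nth
    by (intro sum.cong) auto
  also have "\<dots> = (\<Sum>i\<in>(if even n then {n div 2} else {}). f $ i)"
    by (intro sum.mono_neutral_cong_right) (auto split: if_splits)
  finally show ?thesis by simp
qed

lemma dil_add: "dil (f + g) = dil f + dil g"
  and dil_diff: "dil (f - g) = dil f - dil g"
  and dil_uminus: "dil (- f) = - dil f"
  and dil_mult: "dil (f * g) = dil f * dil g"
  and dil_power: "dil (f ^ k) = dil f ^ k"
  and dil_prod: "dil (prod h S) = (\<Prod>i\<in>S. dil (h i))"
  and dil_1: "dil 1 = 1"
  and dil_0: "dil 0 = 0"
  and dil_X: "dil X = X ^ 2"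
  by (simp_all add: dil_def fps_compose_add_distrib fps_compose_sub_distrib fps_compose_uminus
      fps_compose_mult_distrib fps_compose_power fps_compose_prod_distrib)

lemma dil_of_nat: "dil (of_nat n) = of_nat n"
  by (induction n) (simp_all add: dil_add dil_1 dil_0)

lemma dil_numeral: "dil (numeral k) = numeral k"
  using dil_of_nat[of "numeral k"] by simp

lemmas dil_simps = dil_add dil_diff dil_uminus dil_mult dil_power dil_prod dil_1 dil_0 dil_X
  dil_numeral

lemma dil_inject: "dil f = dil g \<longleftrightarrow> f = g"
proof
  assume "dil f = dil g"
  then have "dil f $ (2 * n) = dil g $ (2 * n)" for n by simp
  then show "f = g" by (simp add: dil_nth fps_eq_iff)
qed simp

text \<open>Nested, these pick out a residue class modulo a power of 2: the operator applied first
  fixes the lowest binary digit of the exponent.\<close>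

definition ev :: "int fps \<Rightarrow> int fps" where "ev f = Abs_fps (\<lambda>n. f $ (2 * n))"
definition od :: "int fps \<Rightarrow> int fps" where "od f = Abs_fps (\<lambda>n. f $ (2 * n + 1))"

lemma ev_nth: "ev f $ n = f $ (2 * n)" and od_nth: "od f $ n = f $ (2 * n + 1)"
  by (simp_all add: ev_def od_def)

lemma ev_dissect: "f = dil a + X * dil b \<Longrightarrow> ev f = a"
  and od_dissect: "f = dil a + X * dil b \<Longrightarrow> od f = b"
  by (simp_all add: fps_eq_iff ev_nth od_nth dil_nth fps_X_mult_nth)

lemma dissect: "f = dil (ev f) + X * dil (od f)"
  by (auto simp: fps_eq_iff ev_nth od_nth dil_nth fps_X_mult_nth elim!: evenE oddE)

section \<open>Even functions modulo a constant\<close>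

text \<open>Evenness in \<open>q\<close> modulo \<open>c\<close>. The witness form, rather than a
  condition on coefficients, makes closure under products plain algebra.\<close>

definition evenmod :: "int fps \<Rightarrow> int fps \<Rightarrow> bool" where
  "evenmod c f \<longleftrightarrow> (\<exists>a b. f = dil a + c * b)"

lemma evenmodI: "f = dil a + c * b \<Longrightarrow> evenmod c f"
  by (auto simp: evenmod_def)

lemma evenmod_dil: "evenmod c (dil f)"
  by (rule evenmodI[where b = 0]) simp

lemma evenmod_const: "evenmod c (c * f)"
  by (rule evenmodI[where a = 0 and b = f]) (simp add: dil_0)

lemma evenmod_numeral: "evenmod c (numeral k)"
  using evenmod_dil[of c "numeral k"] by (simp add: dil_numeral)

lemma evenmod_add:
  assumes "evenmod c f" "evenmod c g" shows "evenmod c (f + g)"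
proof -
  from assms obtain a b a' b' where "f = dil a + c * b" "g = dil a' + c * b'"
    by (auto simp: evenmod_def)
  then have "f + g = dil (a + a') + c * (b + b')"
    by (simp add: dil_simps algebra_simps)
  then show ?thesis by (rule evenmodI)
qed

lemma evenmod_mult:
  assumes "evenmod c f" "evenmod c g" shows "evenmod c (f * g)"
proof -
  from assms obtain a b a' b' where "f = dil a + c * b" "g = dil a' + c * b'"
    by (auto simp: evenmod_def)
  then have "f * g = dil (a * a') + c * (b * dil a' + b' * dil a + c * b * b')"
    by (simp add: dil_simps algebra_simps)
  then show ?thesis by (rule evenmodI)
qed

lemma evenmod_power: "evenmod c f \<Longrightarrow> evenmod c (f ^ k)"
  using evenmod_dil[of c 1] by (induction k) (simp_all add: evenmod_mult dil_1)

text \<open>This is how the power of 2 in front of a dissected series combines with the evenness of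
  its remaining factors.\<close>

lemma evenmod_scale:
  assumes "evenmod c f" shows "evenmod (numeral k * c) (numeral k * f)"
proof -
  from assms obtain a b where "f = dil a + c * b"
    by (auto simp: evenmod_def)
  then have "numeral k * f = dil (numeral k * a) + numeral k * c * b"
    by (simp add: dil_simps algebra_simps)
  then show ?thesis by (rule evenmodI)
qed

lemma evenmod_dvd: "c dvd c' \<Longrightarrow> evenmod c' f \<Longrightarrow> evenmod c f"
  by (force simp: evenmod_def dvd_def mult.assoc)

lemma evenmod_odd_nth:
  assumes "evenmod (numeral c) f" shows "numeral c dvd f $ (2 * n + 1)"
proof -
  from assms obtain a b where "f = dil a + numeral c * b"
    by (auto simp: evenmod_def)
  then show ?thesis by (simp add: dil_nth numeral_fps_const)
qed

section \<open>Generating functions of weighted sets and theta functions\<close>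

definition gen :: "'a set \<Rightarrow> ('a \<Rightarrow> nat) \<Rightarrow> int fps" where
  "gen A w = Abs_fps (\<lambda>n. int (card {a \<in> A. w a = n}))"

text \<open>Since \<open>card\<close> is 0 on infinite sets, the sum and product rules for
  \<open>gen\<close> carry this hypothesis; bijections, dilation and shifts preserve
  \<open>gen\<close> identities without it.\<close>

definition finite_fibres :: "'a set \<Rightarrow> ('a \<Rightarrow> nat) \<Rightarrow> bool" where
  "finite_fibres A w \<longleftrightarrow> (\<forall>n. finite {a \<in> A. w a = n})"

lemma gen_nth: "gen A w $ n = int (card {a \<in> A. w a = n})"
  by (simp add: gen_def)

lemma finite_fibres_subset:
  assumes "finite_fibres A w" "B \<subseteq> A"
  shows "finite_fibres B w"
  unfolding finite_fibres_def
proof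
  fix n
  have "{a \<in> B. w a = n} \<subseteq> {a \<in> A. w a = n}"
    using assms(2) by auto
  then show "finite {a \<in> B. w a = n}"
    by (rule finite_subset) (use assms(1) in \<open>simp add: finite_fibres_def\<close>)
qed

lemma finite_fibres_finite: "finite A \<Longrightarrow> finite_fibres A w"
  by (simp add: finite_fibres_def)

lemma gen_bij:
  assumes "bij_betw h A B" "\<And>a. a \<in> A \<Longrightarrow> v (h a) = w a"
  shows "gen A w = gen B v"
proof -
  have "bij_betw h {a \<in> A. w a = n} {b \<in> B. v b = n}" for n
  proof (rule bij_betw_subset[OF assms(1)])
    show "h ` {a \<in> A. w a = n} = {b \<in> B. v b = n}"
      using assms by (auto simp: bij_betw_def image_iff)
  qed auto
  from bij_betw_same_card[OF this] show ?thesis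
    by (simp add: fps_eq_iff gen_nth)
qed

lemma gen_Un:
  assumes "finite_fibres A w" "finite_fibres B w" "A \<inter> B = {}"
  shows "gen (A \<union> B) w = gen A w + gen B w"
proof -
  have "card {a \<in> A \<union> B. w a = n} = card {a \<in> A. w a = n} + card {a \<in> B. w a = n}" for n
    using assms by (subst card_Un_disjoint[symmetric])
      (auto simp: finite_fibres_def intro!: arg_cong[where f = card])
  then show ?thesis
    by (simp add: fps_eq_iff gen_nth)
qed

lemma sum_fibre:
  fixes w :: "'a \<Rightarrow> nat" and v :: "'b \<Rightarrow> nat"
  shows "{p \<in> A \<times> B. w (fst p) + v (snd p) = n} =
    (\<Union>i\<in>{0..n}. {a \<in> A. w a = i} \<times> {b \<in> B. v b = n - i})"
  by auto

lemma finite_fibres_Times: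
  assumes "finite_fibres A w" "finite_fibres B v"
  shows "finite_fibres (A \<times> B) (\<lambda>p. w (fst p) + v (snd p))"
  using assms unfolding finite_fibres_def sum_fibre by blast

lemma gen_mult:
  assumes "finite_fibres A w" "finite_fibres B v"
  shows "gen A w * gen B v = gen (A \<times> B) (\<lambda>p. w (fst p) + v (snd p))"
proof -
  have "card {p \<in> A \<times> B. w (fst p) + v (snd p) = n} =
      (\<Sum>i=0..n. card {a \<in> A. w a = i} * card {b \<in> B. v b = n - i})" for n
    unfolding sum_fibre using assms
    by (subst card_UN_disjoint) (auto simp: finite_fibres_def)
  then show ?thesis
    by (simp add: fps_eq_iff gen_nth fps_mult_nth)
qed

lemma dil_gen: "dil (gen A w) = gen A (\<lambda>a. 2 * w a)"
proof -
  have "{a \<in> A. 2 * w a = n} = (if even n then {a \<in> A. w a = n div 2} else {})" for n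
    by auto
  then show ?thesis
    by (simp add: fps_eq_iff gen_nth dil_nth)
qed

lemma X_power_gen: "X ^ k * gen A w = gen A (\<lambda>a. w a + k)"
proof -
  have "{a \<in> A. w a + k = n} = (if n < k then {} else {a \<in> A. w a = n - k})" for n
    by auto
  then show ?thesis
    by (simp add: fps_eq_iff gen_nth fps_X_power_mult_nth)
qed

lemma gen_finite: "finite A \<Longrightarrow> gen A w = (\<Sum>a\<in>A. X ^ w a)"
proof (induction A rule: finite_induct)
  case empty
  show ?case by (simp add: fps_eq_iff gen_nth)
next
  case (insert a A)
  have "gen {a} w = X ^ w a"
    by (auto simp: fps_eq_iff gen_nth fps_X_power_nth conj_commute cong: conj_cong)
  with insert gen_Un[of "{a}" w A] show ?case
    by (simp add: finite_fibres_finite)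
qed

section \<open>The theta series and their dissections\<close>

definition sq :: "int \<Rightarrow> nat" where "sq x = nat (x ^ 2)"
definition tri :: "nat \<Rightarrow> nat" where "tri k = k * (k + 1) div 2"

definition phi :: "int fps" where "phi = gen UNIV sq"
definition psi :: "int fps" where "psi = gen UNIV tri"

lemma finite_fibres_sq: "finite_fibres A sq"
proof -
  have "{x \<in> A. sq x = n} \<subseteq> {- int n..int n}" for n
  proof
    fix x assume "x \<in> {x \<in> A. sq x = n}"
    then have "x ^ 2 = int n"
      by (auto simp: sq_def)
    moreover have "\<bar>x\<bar> * 1 \<le> \<bar>x\<bar> * \<bar>x\<bar>"
    proof (cases "x = 0")
      case False
      then show ?thesis by (intro mult_left_mono) auto
    qed simp
    then have "\<bar>x\<bar> \<le> x ^ 2"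
      by (simp add: power2_eq_square flip: abs_mult)
    ultimately show "x \<in> {- int n..int n}"
      by auto
  qed
  then show ?thesis
    unfolding finite_fibres_def by (meson finite_subset finite_atLeastAtMost_int)
qed

definition phi0 :: "int fps" where "phi0 = gen {x. even x} sq"
definition phi1 :: "int fps" where "phi1 = gen {x. odd x} sq"

lemma phi_split: "phi = phi0 + phi1"
proof -
  have "phi = gen ({x. even x} \<union> {x. odd x}) sq"
    unfolding phi_def by (rule arg_cong[where f = "\<lambda>A. gen A sq"]) auto
  also have "\<dots> = phi0 + phi1"
    unfolding phi0_def phi1_def by (intro gen_Un finite_fibres_sq) auto
  finally show ?thesis .
qed

lemma phi0: "phi0 = dil (dil phi)"
  unfolding phi0_def phi_def dil_gen
  by (intro gen_bij[symmetric, where h = "\<lambda>x. 2 * x"] bij_betwI[where g = "\<lambda>x. x div 2"])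
     (auto simp: sq_def power_mult_distrib nat_mult_distrib)

lemma sq_odd: "sq (2 * int k + 1) = 2 * (2 * (2 * tri k)) + 1"
proof -
  have "2 * tri k = k * (k + 1)"
    by (simp add: tri_def)
  then have "2 * (2 * (2 * tri k)) + 1 = 4 * (k * (k + 1)) + 1"
    by simp
  moreover have "(2 * int k + 1) ^ 2 = int (4 * (k * (k + 1)) + 1)"
    by (simp add: power2_eq_square algebra_simps)
  ultimately show ?thesis
    unfolding sq_def by (metis nat_int)
qed

text \<open>Positive and negative odd integers contribute equally, which gives the 2, and
  \<open>(2 * k + 1)^2 = 8 * tri k + 1\<close> gives the factor \<open>X\<close> and the three
  dilations.\<close>

lemma phi1: "phi1 = 2 * X * dil (dil (dil psi))"
proof -
  have psi: "X * dil (dil (dil psi)) = gen UNIV (\<lambda>k. 2 * (2 * (2 * tri k)) + 1)"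
    using X_power_gen[of 1] by (simp add: psi_def dil_gen)
  have "phi1 = gen ({x. odd x \<and> x > 0} \<union> {x. odd x \<and> x < 0}) sq"
    unfolding phi1_def by (rule arg_cong[where f = "\<lambda>A. gen A sq"]) (auto elim!: oddE)
  also have "\<dots> = gen {x. odd x \<and> x > 0} sq + gen {x. odd x \<and> x < 0} sq"
    by (intro gen_Un finite_fibres_sq) auto
  also have "gen {x. odd x \<and> x > 0} sq = X * dil (dil (dil psi))"
    unfolding psi
    by (intro gen_bij[symmetric, where h = "\<lambda>k. 2 * int k + 1"]
        bij_betwI[where g = "\<lambda>x. nat (x div 2)"] sq_odd) (auto elim!: oddE)
  also have "gen {x. odd x \<and> x < 0} sq = X * dil (dil (dil psi))"
  proof -
    have "sq (- (2 * int k + 1)) = 2 * (2 * (2 * tri k)) + 1" for k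
      using sq_odd[of k] unfolding sq_def power2_minus .
    then show ?thesis
      unfolding psi
      by (intro gen_bij[symmetric, where h = "\<lambda>k. - (2 * int k + 1)"]
          bij_betwI[where g = "\<lambda>x. nat ((- x) div 2)"]) (auto elim!: oddE)
  qed
  finally show ?thesis by (simp add: mult.assoc)
qed

abbreviation sq2 :: "int \<times> int \<Rightarrow> nat" where "sq2 p \<equiv> sq (fst p) + sq (snd p)"

lemma sq2_rotate: "sq2 (u + v, u - v) = 2 * sq2 (u, v)"
proof -
  have "int (sq x) = x ^ 2" for x
    by (simp add: sq_def)
  then have "int (sq2 (u + v, u - v)) = int (2 * sq2 (u, v))"
    by (simp add: power2_eq_square algebra_simps)
  then show ?thesis
    by (simp only: of_nat_eq_iff)
qed

lemma finite_fibres_sq2: "finite_fibres A sq2"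
proof (rule finite_fibres_subset)
  show "finite_fibres (UNIV \<times> UNIV) sq2"
    by (rule finite_fibres_Times[of UNIV sq UNIV sq, OF finite_fibres_sq finite_fibres_sq])
  show "A \<subseteq> UNIV \<times> UNIV"
    by (simp only: UNIV_Times_UNIV subset_UNIV)
qed

text \<open>A rotation of the lattice of pairs by 45 degrees with scaling: its image is the pairs of
  equal parity. \<open>P\<close> acts on the parity of \<open>u + v\<close>, which is the parity of
  \<open>x\<close>, so one statement serves for all pairs and for those with \<open>u + v\<close>
  odd.\<close>

lemma rotate_image:
  "(\<lambda>(u, v). (u + v, u - v)) ` {(u, v). P (even (u + v))} =
    {(x :: int, y). even x = even y \<and> P (even x)}" (is "?h ` ?A = ?B")
proof
  show "?h ` ?A \<subseteq> ?B"
    by auto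
  have "(x, y) \<in> ?h ` ?A" if "even x = even y" "P (even x)" for x y
  proof (rule image_eqI)
    have x: "x = (x + y) div 2 + (x - y) div 2" and y: "y = (x + y) div 2 - (x - y) div 2"
      using that(1) by presburger+
    then show "(x, y) = ?h ((x + y) div 2, (x - y) div 2)"
      by simp
    have "P (even ((x + y) div 2 + (x - y) div 2))"
      by (rule subst[OF x, where P = "\<lambda>z. P (even z)"]) (rule that(2))
    then show "((x + y) div 2, (x - y) div 2) \<in> ?A"
      by blast
  qed
  then show "?B \<subseteq> ?h ` ?A"
    by blast
qed

lemma gen_rotate:
  "gen {(u, v). P (even (u + v))} (\<lambda>p. 2 * sq2 p) = gen {(x, y). even x = even y \<and> P (even x)} sq2"
proof (rule gen_bij)
  have "inj_on (\<lambda>(u, v). (u + v, u - v :: int)) {(u, v). P (even (u + v))}"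
    by (rule inj_on_subset[of _ UNIV]) (auto simp: inj_on_def)
  then show "bij_betw (\<lambda>(u, v). (u + v, u - v :: int)) {(u, v). P (even (u + v))}
      {(x, y). even x = even y \<and> P (even x)}"
    by (simp only: bij_betw_def rotate_image simp_thms)
  show "sq2 (case p of (u, v) \<Rightarrow> (u + v, u - v)) = 2 * sq2 p" for p
    using sq2_rotate[of "fst p" "snd p"] by (simp only: case_prod_beta prod.collapse)
qed

text \<open>\<open>phi ^ 2\<close> counts pairs by \<open>sq2\<close>; doubling the weight rotates
  them onto the pairs that are both even or both odd.\<close>

lemma dil_phi_square: "dil (phi ^ 2) = phi0 ^ 2 + phi1 ^ 2"
proof -
  have "dil (phi ^ 2) = gen {(u, v). True} (\<lambda>p. 2 * sq2 p)"
    by (simp add: power2_eq_square phi_def gen_mult[OF finite_fibres_sq finite_fibres_sq] dil_gen)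
  also have "\<dots> = gen {(x, y). even x = even y} sq2"
    using gen_rotate[of "\<lambda>_. True"] by simp
  also have "{(x, y). even x = even y} = {x :: int. even x} \<times> {x. even x} \<union> {x. odd x} \<times> {x. odd x}"
    by blast
  also have "gen \<dots> sq2 = phi0 ^ 2 + phi1 ^ 2"
    unfolding power2_eq_square phi0_def phi1_def gen_mult[OF finite_fibres_sq finite_fibres_sq]
    by (intro gen_Un finite_fibres_sq2) auto
  finally show ?thesis .
qed

text \<open>The mixed terms come from pairs with \<open>u + v\<close> odd, which the rotation
  carries onto the pairs of two odd integers.\<close>

lemma dil_phi01: "dil (2 * phi0 * phi1) = phi1 ^ 2"
proof -
  have "2 * phi0 * phi1 = phi0 * phi1 + phi1 * phi0"
    by simp
  also have "\<dots> = gen ({x. even x} \<times> {x. odd x} \<union> {x. odd x} \<times> {x. even x}) sq2"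
    unfolding phi0_def phi1_def gen_mult[OF finite_fibres_sq finite_fibres_sq]
    by (intro gen_Un[symmetric] finite_fibres_sq2) auto
  also have "{x. even x} \<times> {x. odd x} \<union> {x. odd x} \<times> {x. even x} = {(u :: int, v). odd (u + v)}"
    by (simp add: set_eq_iff) blast
  finally have "dil (2 * phi0 * phi1) = gen {(u, v). odd (u + v)} (\<lambda>p. 2 * sq2 p)"
    by (simp only: dil_gen)
  also have "\<dots> = gen {(x, y). even x = even y \<and> odd x} sq2"
    by (rule gen_rotate[of Not])
  also have "{(x, y). even x = even y \<and> odd x} = {x :: int. odd x} \<times> {x. odd x}"
    by blast
  also have "gen \<dots> sq2 = phi1 ^ 2"
    by (simp add: power2_eq_square phi1_def gen_mult[OF finite_fibres_sq finite_fibres_sq])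
  finally show ?thesis .
qed

lemma phi01: "2 * phi0 * phi1 = 4 * X * dil (dil (psi ^ 2))"
proof -
  \<comment> \<open>Both sides equal \<open>phi1 ^ 2\<close>, and a dilation can be
    cancelled.\<close>
  have "dil (2 * phi0 * phi1) = dil (4 * X * dil (dil (psi ^ 2)))"
    unfolding dil_phi01 by (simp add: phi1 dil_simps power_mult_distrib)
  then show ?thesis
    by (simp only: dil_inject)
qed

lemma phi_square: "phi ^ 2 = dil (phi ^ 2) + 4 * X * dil (dil (psi ^ 2))"
proof -
  have "phi ^ 2 = phi0 ^ 2 + phi1 ^ 2 + 2 * phi0 * phi1"
    by (simp add: phi_split power2_eq_square algebra_simps)
  then show ?thesis
    unfolding dil_phi_square phi01[symmetric] .
qed

text \<open>Two evaluations of \<open>2 * phi0 * phi1\<close> are compared: \<open>phi01\<close>,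
  and the product of the separate formulas for \<open>phi0\<close> and \<open>phi1\<close>.\<close>

lemma phi_psi: "phi * dil psi = psi ^ 2"
proof -
  have "4 * X * dil (dil (phi * dil psi)) = 4 * X * dil (dil (psi ^ 2))"
    using phi01 by (simp add: phi0 phi1 dil_mult mult_ac)
  then show ?thesis
    by (simp add: dil_inject)
qed

lemma phi_dissect: "phi = dil (dil phi) + 2 * X * dil (dil (dil psi))"
  using phi_split phi0 phi1 by simp

section \<open>Gauss's product formulas\<close>

text \<open>
  Finite forms of Gauss's identities in the style of Shanks: as \<open>n\<close> grows, only the product survives on the
  right.  Both inductions work because the difference of consecutive right-hand sides telescopes
  in \<open>s\<close>.
\<close>
lemma gauss_square_finite:
  fixes q :: "'a::comm_ring_1"
  assumes inv: "\<And>k. k \<ge> 1 \<Longrightarrow> (1 + q ^ k) * i k = 1"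
  shows "1 + 2 * (\<Sum>k=1..n. (- 1) ^ k * q ^ (k ^ 2)) = (\<Prod>k=1..n. (1 - q ^ k) * i k) +
    2 * (\<Sum>s=1..n. (- 1) ^ s * i s * (\<Prod>k=s+1..n. (1 - q ^ k) * i k) * q ^ (s * (n + 1)))"
proof (induction n)
  case 0
  show ?case by simp
next
  case (Suc n)
  define c where "c k = (1 - q ^ k) * i k" for k
  define N where "N = n + 1"
  \<comment> \<open>\<open>w\<close> is the antidifference: by \<open>step\<close>, raising
    \<open>n\<close> to \<open>N\<close> changes each summand by \<open>i N\<close> times a
    difference of \<open>w\<close>.\<close>
  define w where "w s = (- 1) ^ s * q ^ (s * N) * prod c {s..n}" for s
  define t where "t m s = (- 1) ^ s * i s * prod c {s+1..m} * q ^ (s * (m + 1))" for m s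
  have iN: "i N * (1 + q ^ N) = 1"
    using inv[of N] by (simp add: N_def mult.commute)
  have step: "t N s - t n s = i N * (w (s + 1) - w s)" if "s \<in> {1..n}" for s
  proof -
    define P where "P = prod c {s+1..n}"
    have i_s: "i s * (1 + q ^ s) = 1"
      using inv[of s] that by (simp add: mult.commute)
    have PN: "prod c {s+1..N} = P * c N"
      using that by (simp add: N_def P_def)
    have Ps: "prod c {s..n} = c s * P"
      using that by (simp add: P_def prod.atLeast_Suc_atMost)
    have "t N s = (- 1) ^ s * i s * (P * c N) * (q ^ (s * N) * q ^ s)"
      unfolding t_def PN by (simp add: algebra_simps power_add)
    also have "\<dots> = (- 1) ^ s * q ^ (s * N) * P * i N * (i s * q ^ s * (1 - q ^ N))"
      by (simp add: c_def mult_ac)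
    finally have tN: "t N s = \<dots>" .
    have "t n s = (- 1) ^ s * i s * P * q ^ (s * N) * (i N * (1 + q ^ N))"
      unfolding iN by (simp add: t_def P_def N_def)
    also have "\<dots> = (- 1) ^ s * q ^ (s * N) * P * i N * (i s * (1 + q ^ N))"
      by (simp add: mult_ac)
    finally have tn: "t n s = \<dots>" .
    have "w (s + 1) - w s = (- 1) ^ s * q ^ (s * N) * P * (- (q ^ N) - (1 - q ^ s) * i s)"
      unfolding w_def Ps by (simp add: P_def c_def algebra_simps power_add)
    \<comment> \<open>A factor \<open>i s * (1 + q ^ s) = 1\<close> is inserted so that every term
      carries \<open>i s\<close>; the terms in \<open>q ^ s\<close> then regroup.\<close>
    also have "- (q ^ N) - (1 - q ^ s) * i s = - (q ^ N) * (i s * (1 + q ^ s)) - (1 - q ^ s) * i s"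
      by (simp add: i_s)
    also have "\<dots> = i s * q ^ s * (1 - q ^ N) - i s * (1 + q ^ N)"
      by (simp add: algebra_simps)
    finally have dw: "w (s + 1) - w s =
        (- 1) ^ s * q ^ (s * N) * P * (i s * q ^ s * (1 - q ^ N) - i s * (1 + q ^ N))" .
    show ?thesis
      unfolding tN tn dw by (simp only: right_diff_distrib mult_ac)
  qed
  \<comment> \<open>The change of the product is twice \<open>i N * w 1\<close>, which cancels the
    lower boundary term of the telescoped sum.\<close>
  have "prod c {1..N} - prod c {1..n} = prod c {1..n} * (c N - i N * (1 + q ^ N))"
    by (simp add: iN) (simp add: N_def algebra_simps)
  also have "\<dots> = 2 * (i N * w 1)"
    by (simp add: c_def[of N] w_def algebra_simps)
  finally have prodN: "prod c {1..N} = prod c {1..n} + 2 * (i N * w 1)"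
    by (simp add: algebra_simps)
  have sumN: "sum (t N) {1..N} = sum (t n) {1..n} + (i N * w N + t N N) - i N * w 1"
  proof -
    have "sum (t N) {1..n} - sum (t n) {1..n} = i N * (\<Sum>s=1..n. w (Suc s) - w s)"
      by (simp add: step sum_distrib_left flip: sum_subtractf)
    also have "\<dots> = i N * (w N - w 1)"
      by (subst sum_Suc_diff) (simp_all add: N_def)
    finally show ?thesis
      by (simp add: N_def algebra_simps)
  qed
  \<comment> \<open>The upper boundary term and the new summand \<open>s = N\<close> combine into
    the next square power of \<open>q\<close>.\<close>
  have last: "i N * w N + t N N = (- 1) ^ N * q ^ (N ^ 2) * (i N * (1 + q ^ N))"
    by (simp add: w_def t_def N_def algebra_simps power_add power2_eq_square)
  have "prod c {1..N} + 2 * sum (t N) {1..N} =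
      prod c {1..n} + 2 * sum (t n) {1..n} + 2 * ((- 1) ^ N * q ^ (N ^ 2))"
    unfolding prodN sumN last iN by (simp add: algebra_simps)
  also have "prod c {1..n} + 2 * sum (t n) {1..n} = 1 + 2 * (\<Sum>k=1..n. (- 1) ^ k * q ^ (k ^ 2))"
    using Suc.IH by (simp add: t_def c_def)
  finally show ?case
    by (simp add: t_def c_def N_def algebra_simps)
qed

lemma gauss_triangular_finite:
  fixes q :: "'a::comm_ring_1"
  assumes inv: "\<And>k. k \<ge> 1 \<Longrightarrow> (1 - q ^ (2 * k - 1)) * j k = 1"
  shows "(\<Sum>k=0..2*n. q ^ (k * (k + 1) div 2)) =
    (\<Sum>s=0..n. (\<Prod>k=s+1..n. (1 - q ^ (2 * k)) * j k) * q ^ (s * (2 * n + 1)))"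
proof (induction n)
  case 0
  show ?case by simp
next
  case (Suc n)
  define c where "c k = (1 - q ^ (2 * k)) * j k" for k
  define N where "N = n + 1"
  \<comment> \<open>At \<open>s = 0\<close> natural subtraction makes \<open>2 * s - 1\<close> equal
    to 0, so \<open>w 0 = 0\<close> and the telescoped sum has no lower boundary term.\<close>
  define w where "w s = q ^ (s * (2 * n + 1)) * (1 - q ^ (2 * s - 1)) * prod c {s..n}" for s
  define t where "t m s = prod c {s+1..m} * q ^ (s * (2 * m + 1))" for m s
  have jN: "j N * (1 - q ^ (2 * n + 1)) = 1"
    using inv[of N] by (simp add: N_def mult.commute)
  have step: "t N s - t n s = j N * (w (s + 1) - w s)" if "s \<in> {0..n}" for s
  proof -
    define P where "P = prod c {s+1..n}"
    have PN: "prod c {s+1..N} = P * c N"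
      using that by (simp add: N_def P_def)
    have Ps: "(1 - q ^ (2 * s - 1)) * prod c {s..n} = (1 - q ^ (2 * s)) * P"
    proof (cases "s = 0")
      case False
      then have "(1 - q ^ (2 * s - 1)) * c s = 1 - q ^ (2 * s)"
        using inv[of s] by (simp add: c_def mult.left_commute)
      then show ?thesis
        using that by (simp add: P_def prod.atLeast_Suc_atMost flip: mult.assoc)
    qed simp
    have tN: "t N s = q ^ (s * (2 * n + 1)) * P * j N * (q ^ (2 * s) * (1 - q ^ (2 * N)))"
      unfolding t_def PN by (simp add: c_def N_def algebra_simps flip: power_add)
    have "t n s = q ^ (s * (2 * n + 1)) * P * (j N * (1 - q ^ (2 * n + 1)))"
      unfolding jN by (simp add: t_def P_def)
    then have tn: "t n s = q ^ (s * (2 * n + 1)) * P * j N * (1 - q ^ (2 * n + 1))"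
      by (simp only: mult.assoc)
    have w1: "w (s + 1) = q ^ (s * (2 * n + 1)) * P * (q ^ (2 * n + 1) * (1 - q ^ (2 * s + 1)))"
      by (simp add: w_def P_def algebra_simps power_add)
    have w0: "w s = q ^ (s * (2 * n + 1)) * P * (1 - q ^ (2 * s))"
      unfolding w_def mult.assoc Ps by (simp add: mult_ac)
    show ?thesis
      unfolding tN tn w1 w0 by (simp add: N_def algebra_simps power_add)
  qed
  have "sum (t N) {0..n} - sum (t n) {0..n} = j N * (\<Sum>s=0..n. w (Suc s) - w s)"
    by (simp add: step sum_distrib_left flip: sum_subtractf)
  also have "\<dots> = j N * (w N - w 0)"
    by (subst sum_Suc_diff) (simp_all add: N_def)
  also have "\<dots> = q ^ (N * (2 * n + 1)) * (j N * (1 - q ^ (2 * n + 1)))"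
    by (simp add: w_def N_def mult_ac)
  finally have "sum (t N) {0..N} = sum (t n) {0..n} + q ^ (N * (2 * n + 1)) + t N N"
    unfolding jN by (simp add: N_def algebra_simps)
  moreover have "t N N = q ^ (N * (2 * N + 1))"
    by (simp add: t_def)
  ultimately have "sum (t N) {0..N} = sum (t n) {0..n} + q ^ (N * (2 * n + 1)) + q ^ (N * (2 * N + 1))"
    by simp
  also have "sum (t n) {0..n} = (\<Sum>k=0..2*n. q ^ (k * (k + 1) div 2))"
    using Suc.IH by (simp add: t_def c_def)
  \<comment> \<open>The two new exponents are the triangular numbers with indices
    \<open>2 * n + 1\<close> and \<open>2 * n + 2\<close>, so one induction step adds two terms on
    the left.\<close>
  also have "N * (2 * n + 1) = (2 * n + 1) * (2 * n + 1 + 1) div 2"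
  proof -
    have "(2 * n + 1) * (2 * n + 1 + 1) = 2 * (N * (2 * n + 1))"
      by (simp add: N_def algebra_simps)
    then show ?thesis by simp
  qed
  also have "N * (2 * N + 1) = (2 * n + 2) * (2 * n + 2 + 1) div 2"
  proof -
    have "(2 * n + 2) * (2 * n + 2 + 1) = 2 * (N * (2 * N + 1))"
      by (simp add: N_def algebra_simps)
    then show ?thesis by simp
  qed
  finally have "sum (t N) {0..N} = (\<Sum>k=0..2*n. q ^ (k * (k + 1) div 2))
      + q ^ ((2 * n + 1) * (2 * n + 1 + 1) div 2) + q ^ ((2 * n + 2) * (2 * n + 2 + 1) div 2)" .
  also have "\<dots> = (\<Sum>k=0..Suc (Suc (2 * n)). q ^ (k * (k + 1) div 2))"
    unfolding sum.atLeast0_atMost_Suc by simp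
  finally show ?case
    by (simp add: t_def c_def N_def)
qed

section \<open>Truncated comparison and infinite products\<close>

text \<open>Congruence modulo \<open>X ^ (N + 1)\<close>. It takes the place of convergence:
  infinite products are compared with finite ones order by order.\<close>

definition eqm :: "nat \<Rightarrow> int fps \<Rightarrow> int fps \<Rightarrow> bool" where
  "eqm N f g \<longleftrightarrow> (\<forall>k\<le>N. f $ k = g $ k)"

lemma eqm_refl: "eqm N f f"
  and eqm_sym: "eqm N f g \<Longrightarrow> eqm N g f"
  and eqm_trans [trans]: "eqm N f g \<Longrightarrow> eqm N g h \<Longrightarrow> eqm N f h"
  by (simp_all add: eqm_def)

lemma eqm_add: "eqm N f g \<Longrightarrow> eqm N f' g' \<Longrightarrow> eqm N (f + f') (g + g')"
  by (simp add: eqm_def)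

lemma eqm_mult: "eqm N f g \<Longrightarrow> eqm N f' g' \<Longrightarrow> eqm N (f * f') (g * g')"
  by (simp add: eqm_def fps_mult_nth)

lemma eqm_dil: "eqm N f g \<Longrightarrow> eqm N (dil f) (dil g)"
  by (simp add: eqm_def dil_nth)

lemma eqm_sum: "(\<And>x. x \<in> S \<Longrightarrow> eqm N (f x) (g x)) \<Longrightarrow> eqm N (sum f S) (sum g S)"
  by (simp add: eqm_def fps_sum_nth)

lemma eqm_X_power: "N < k \<Longrightarrow> eqm N (X ^ k * f) 0" "N < k \<Longrightarrow> eqm N (f * X ^ k) 0"
  by (simp_all add: eqm_def fps_X_power_mult_nth fps_X_power_mult_right_nth)

lemma eqmI: "(\<And>N. eqm N f g) \<Longrightarrow> f = g"
  by (auto simp: eqm_def fps_eq_iff)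

lemma eqm_subst_neg: "eqm N f g \<Longrightarrow> eqm N (f oo - X) (g oo - X)"
  by (simp add: eqm_def fps_compose_uminus')

text \<open>The integers are not a field, so inverses are taken only of series with constant term 1;
  the second argument of \<open>fps_right_inverse\<close> is the inverse of that term.\<close>

lemma unit_inverse: "f $ 0 = 1 \<Longrightarrow> f * fps_right_inverse f 1 = (1 :: int fps)"
  by (rule fps_right_inverse) simp

lemma eqm_cancel:
  assumes "eqm N (h * f) (h * g)" "h $ 0 = 1"
  shows "eqm N f g"
proof -
  let ?r = "fps_right_inverse h 1"
  have inv: "?r * (h * f') = f'" for f'
  proof -
    have "?r * (h * f') = (h * ?r) * f'"
      by (simp only: mult_ac)
    then show ?thesis
      by (simp only: unit_inverse[OF assms(2)] mult_1_left)
  qed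
  show ?thesis
    using eqm_mult[OF eqm_refl[of N ?r] assms(1)] unfolding inv .
qed

lemma prod_truncate:
  assumes "finite A" "B \<subseteq> A" "\<And>k. k \<in> A - B \<Longrightarrow> N < k"
  shows "eqm N (\<Prod>k\<in>A. 1 - X ^ k) (\<Prod>k\<in>B. 1 - X ^ k)"
proof -
  have "eqm N (\<Prod>k\<in>C. 1 - X ^ k) 1" if "finite C" "\<And>k. k \<in> C \<Longrightarrow> N < k" for C
    using that
  proof (induction C rule: finite_induct)
    case (insert k C)
    have "eqm N (1 - X ^ k) 1"
      using insert.prems[of k] by (simp add: eqm_def)
    with insert show ?case
      using eqm_mult[of N "1 - X ^ k" 1 "\<Prod>k\<in>C. 1 - X ^ k" 1] by simp
  qed (simp add: eqm_refl)
  then have "eqm N (\<Prod>k\<in>A - B. 1 - X ^ k) 1"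
    using assms by blast
  then have "eqm N ((\<Prod>k\<in>A - B. 1 - X ^ k) * (\<Prod>k\<in>B. 1 - X ^ k)) (1 * (\<Prod>k\<in>B. 1 - X ^ k))"
    by (intro eqm_mult eqm_refl)
  then show ?thesis
    by (simp add: prod.subset_diff[OF assms(2,1)])
qed

definition euler_prod :: "nat \<Rightarrow> int fps" where "euler_prod n = (\<Prod>k=1..n. 1 - X ^ k)"
text \<open>The infinite product \<open>f_1\<close>. Factors beyond the first \<open>n\<close> do
  not affect coefficient \<open>n\<close>, hence the diagonal.\<close>

definition euler :: "int fps" where "euler = Abs_fps (\<lambda>n. euler_prod n $ n)"

lemma eqm_euler_prod: "N \<le> M \<Longrightarrow> eqm N (euler_prod M) (euler_prod N)"
  unfolding euler_prod_def by (rule prod_truncate) auto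

lemma eqm_euler: "eqm N euler (euler_prod N)"
  using eqm_euler_prod by (simp add: eqm_def euler_def)

lemma dil_euler_prod: "dil (euler_prod n) = (\<Prod>k=1..n. 1 - X ^ (2 * k))"
  by (simp add: euler_prod_def dil_simps power_mult)

lemma euler_prod_double: "euler_prod (2 * n) = (\<Prod>k=1..n. 1 - X ^ (2 * k - 1)) * dil (euler_prod n)"
  unfolding dil_euler_prod
  by (induction n) (simp_all add: euler_prod_def)

definition phi_neg :: "int fps" where "phi_neg = phi oo - X"

lemma phi_neg: "phi_neg = dil (dil phi) - 2 * X * dil (dil (dil psi))"
proof -
  have dil_neg: "dil f oo - X = dil f" for f
    by (simp add: fps_eq_iff fps_compose_uminus' dil_nth)
  have "phi_neg = (dil (dil phi) + 2 * X * dil (dil (dil psi))) oo - X"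
    unfolding phi_neg_def by (rule arg_cong[OF phi_dissect])
  also have "\<dots> = dil (dil phi) - 2 * X * dil (dil (dil psi))"
    by (simp add: fps_compose_add_distrib fps_compose_mult_distrib dil_neg numeral_fps_const)
  finally show ?thesis .
qed

lemma gen_truncate:
  assumes "B \<subseteq> A" "\<And>a. a \<in> A - B \<Longrightarrow> N < w a"
  shows "eqm N (gen A w) (gen B w)"
proof -
  have "{a \<in> A. w a = k} = {a \<in> B. w a = k}" if "k \<le> N" for k
    using assms that by force
  then show ?thesis
    by (simp add: eqm_def gen_nth)
qed

lemma phi_truncate: "eqm N phi (1 + 2 * (\<Sum>k=1..N. X ^ (k ^ 2)))"
proof -
  have sq_int: "sq (int k) = k ^ 2" for k
    by (simp add: sq_def nat_power_eq)
  then have sq_neg: "sq (- int k) = k ^ 2" for k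
    by (simp add: sq_def)
  have ge: "N < sq x" if "N < nat \<bar>x\<bar>" for x
  proof -
    have "nat \<bar>x\<bar> * 1 \<le> nat \<bar>x\<bar> * nat \<bar>x\<bar>"
      using that by (intro mult_le_mono2) simp
    moreover have "sq x = nat \<bar>x\<bar> * nat \<bar>x\<bar>"
      using sq_int[of "nat \<bar>x\<bar>"] by (simp add: sq_def power2_eq_square)
    ultimately show ?thesis
      using that by linarith
  qed
  let ?P = "int ` {1..N}" and ?M = "(\<lambda>k. - int k) ` {1..N}"
  have "eqm N phi (gen ({0} \<union> (?P \<union> ?M)) sq)"
    unfolding phi_def
  proof (rule gen_truncate)
    fix x assume x: "x \<in> UNIV - ({0} \<union> (?P \<union> ?M))"
    then have "x \<noteq> 0"
      by blast
    have "\<not> nat \<bar>x\<bar> \<le> N"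
    proof
      assume "nat \<bar>x\<bar> \<le> N"
      moreover have "nat \<bar>x\<bar> \<ge> 1"
        using \<open>x \<noteq> 0\<close> by linarith
      ultimately have "nat \<bar>x\<bar> \<in> {1..N}"
        by simp
      moreover have "x = int (nat \<bar>x\<bar>) \<or> x = - int (nat \<bar>x\<bar>)"
        by linarith
      ultimately show False
        using x by blast
    qed
    then show "N < sq x"
      by (intro ge) simp
  qed simp
  also have "gen ({0} \<union> (?P \<union> ?M)) sq = (\<Sum>x\<in>{0} \<union> (?P \<union> ?M). X ^ sq x)"
    by (intro gen_finite) simp
  also have "\<dots> = X ^ sq 0 + (sum (\<lambda>x. X ^ sq x) ?P + sum (\<lambda>x. X ^ sq x) ?M)"
    by (subst sum.union_disjoint; (subst sum.union_disjoint)?) auto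
  also have "sum (\<lambda>x. X ^ sq x) ?P = (\<Sum>k=1..N. X ^ (k ^ 2))"
    by (subst sum.reindex) (auto simp: sq_int)
  also have "sum (\<lambda>x. X ^ sq x) ?M = (\<Sum>k=1..N. X ^ (k ^ 2))"
    by (subst sum.reindex) (auto simp: sq_neg inj_on_def)
  finally show ?thesis
    by (simp add: sq_def)
qed

lemma psi_truncate: "eqm n psi (\<Sum>k=0..2*n. X ^ (k * (k + 1) div 2))"
proof -
  have "eqm n psi (gen {0..2*n} tri)"
    unfolding psi_def
  proof (rule gen_truncate)
    fix k assume "k \<in> UNIV - {0..2*n}"
    moreover have "k \<le> tri k"
      by (cases k) (auto simp: tri_def)
    ultimately show "n < tri k"
      by simp
  qed simp
  then show ?thesis
    by (simp add: gen_finite tri_def)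
qed

lemma phi_neg_truncate: "eqm N phi_neg (1 + 2 * (\<Sum>k=1..N. (- 1) ^ k * X ^ (k ^ 2)))"
proof -
  have "X ^ (k ^ 2) oo - X = (- 1) ^ k * X ^ (k ^ 2)" for k
    by (cases "even k") (auto simp: fps_eq_iff fps_compose_uminus' fps_X_power_nth)
  moreover have "(2 :: int fps) oo - X = 2"
    by (simp add: numeral_fps_const)
  ultimately show ?thesis
    using eqm_subst_neg[OF phi_truncate[of N]] unfolding phi_neg_def
    by (simp add: fps_compose_add_distrib fps_compose_mult_distrib fps_compose_sum_distrib)
qed

lemma prod_unit_inverse:
  assumes "\<And>k. k \<in> S \<Longrightarrow> f k * i k = (1 :: int fps)"
  shows "(\<Prod>k\<in>S. f k) * (\<Prod>k\<in>S. g k * i k) = (\<Prod>k\<in>S. g k)"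
  unfolding prod.distrib[symmetric] using assms by (intro prod.cong) (auto simp: mult.left_commute)

text \<open>In \<open>gauss_square_finite\<close> each summand carries
  \<open>X ^ (s * (n + 1))\<close> with \<open>s \<ge> 1\<close> and vanishes to order
  \<open>n\<close>; multiplying out the denominators of the remaining product gives the
  claim.\<close>

lemma phi_neg_product: "eqm n ((\<Prod>k=1..n. 1 + X ^ k) * phi_neg) (euler_prod n)"
proof -
  define i where "i k = fps_right_inverse (1 + X ^ k) 1" for k
  have inv: "(1 + X ^ k) * i k = 1" if "k \<ge> 1" for k
    unfolding i_def using that by (intro unit_inverse) simp
  let ?c = "\<lambda>k. (1 - X ^ k) * i k"
  have "eqm n phi_neg (prod ?c {1..n} +
      2 * (\<Sum>s=1..n. (- 1) ^ s * i s * prod ?c {s+1..n} * X ^ (s * (n + 1))))"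
    using phi_neg_truncate[of n] gauss_square_finite[of X i n] inv by simp
  also have "eqm n \<dots> (prod ?c {1..n} + 2 * (\<Sum>s=1..n. 0))"
  proof (intro eqm_add eqm_mult eqm_refl eqm_sum eqm_X_power)
    show "n < s * (n + 1)" if "s \<in> {1..n}" for s
      using that by (cases s) auto
  qed
  finally have "eqm n phi_neg (prod ?c {1..n})"
    by simp
  then have "eqm n ((\<Prod>k=1..n. 1 + X ^ k) * phi_neg) ((\<Prod>k=1..n. 1 + X ^ k) * prod ?c {1..n})"
    by (intro eqm_mult eqm_refl)
  also have "(\<Prod>k=1..n. 1 + X ^ k) * prod ?c {1..n} = euler_prod n"
    unfolding euler_prod_def by (rule prod_unit_inverse) (simp add: inv)
  finally show ?thesis .
qed

text \<open>To order \<open>n\<close> only the summand \<open>s = 0\<close> of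
  \<open>gauss_triangular_finite\<close> survives.\<close>

lemma psi_product: "eqm n ((\<Prod>k=1..n. 1 - X ^ (2 * k - 1)) * psi) (dil (euler_prod n))"
proof -
  define j where "j k = fps_right_inverse (1 - X ^ (2 * k - 1)) 1" for k
  have inv: "(1 - X ^ (2 * k - 1)) * j k = 1" if "k \<ge> 1" for k
    unfolding j_def using that by (intro unit_inverse) simp
  let ?c = "\<lambda>k. (1 - X ^ (2 * k)) * j k"
  have "eqm n psi (\<Sum>s=0..n. prod ?c {s+1..n} * X ^ (s * (2 * n + 1)))"
    using psi_truncate[of n] gauss_triangular_finite[of X j n] inv by simp
  also have "\<dots> = prod ?c {1..n} + (\<Sum>s=1..n. prod ?c {s+1..n} * X ^ (s * (2 * n + 1)))"
    by (simp add: sum.atLeast_Suc_atMost)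
  also have "eqm n \<dots> (prod ?c {1..n} + (\<Sum>s=1..n. 0))"
  proof (intro eqm_add eqm_refl eqm_sum eqm_X_power)
    show "n < s * (2 * n + 1)" if "s \<in> {1..n}" for s
      using that by (cases s) auto
  qed
  finally have "eqm n psi (prod ?c {1..n})"
    by simp
  then have "eqm n ((\<Prod>k=1..n. 1 - X ^ (2 * k - 1)) * psi)
      ((\<Prod>k=1..n. 1 - X ^ (2 * k - 1)) * prod ?c {1..n})"
    by (intro eqm_mult eqm_refl)
  also have "(\<Prod>k=1..n. 1 - X ^ (2 * k - 1)) * prod ?c {1..n} = dil (euler_prod n)"
    unfolding dil_euler_prod by (rule prod_unit_inverse) (simp only: inv atLeastAtMost_iff)
  finally show ?thesis .
qed

text \<open>The factors \<open>(1 - X ^ k) * (1 + X ^ k)\<close> multiply to the truncated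
  \<open>f_2\<close>.\<close>

lemma euler_phi_neg: "euler ^ 2 = dil euler * phi_neg"
proof (rule eqmI)
  fix n
  have "eqm n (euler ^ 2) (euler_prod n * euler_prod n)"
    unfolding power2_eq_square by (intro eqm_mult eqm_euler)
  also have "eqm n \<dots> (euler_prod n * ((\<Prod>k=1..n. 1 + X ^ k) * phi_neg))"
    by (intro eqm_mult eqm_refl eqm_sym[OF phi_neg_product])
  also have "\<dots> = dil (euler_prod n) * phi_neg"
  proof -
    have "euler_prod n * (\<Prod>k=1..n. 1 + X ^ k) = dil (euler_prod n)"
      unfolding dil_euler_prod unfolding euler_prod_def prod.distrib[symmetric]
      by (intro prod.cong refl) (simp only: power_even_eq power2_eq_square, simp add: algebra_simps)
    then show ?thesis
      by (simp flip: mult.assoc)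
  qed
  also have "eqm n \<dots> (dil euler * phi_neg)"
    by (intro eqm_mult eqm_refl eqm_dil eqm_sym[OF eqm_euler])
  finally show "eqm n (euler ^ 2) (dil euler * phi_neg)" .
qed

text \<open>Taking \<open>2 * n\<close> factors of \<open>euler\<close> and separating odd from even
  exponents, the odd ones cancel the denominator of \<open>psi\<close>.\<close>

lemma euler_psi: "euler * psi = dil (euler ^ 2)"
proof (rule eqmI)
  fix n
  have "eqm n euler (euler_prod (2 * n))"
    using eqm_trans[OF eqm_euler eqm_sym[OF eqm_euler_prod]] by simp
  then have "eqm n (euler * psi) (euler_prod (2 * n) * psi)"
    by (intro eqm_mult eqm_refl)
  also have "\<dots> = dil (euler_prod n) * ((\<Prod>k=1..n. 1 - X ^ (2 * k - 1)) * psi)"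
    unfolding euler_prod_double by (simp only: mult_ac)
  also have "eqm n \<dots> (dil (euler_prod n) * dil (euler_prod n))"
    by (intro eqm_mult eqm_refl psi_product)
  also have "eqm n \<dots> (dil (euler ^ 2))"
    unfolding power2_eq_square dil_mult by (intro eqm_mult eqm_dil eqm_sym[OF eqm_euler])
  finally show "eqm n (euler * psi) (dil (euler ^ 2))" .
qed

section \<open>The overpartition generating function\<close>

definition multisets_over :: "nat set \<Rightarrow> nat multiset set" where
  "multisets_over A = {M. set_mset M \<subseteq> A}"

lemma finite_fibres_multisets:
  assumes "0 \<notin> A" shows "finite_fibres (multisets_over A) sum_mset"
  unfolding finite_fibres_def
proof
  fix n
  have "{M \<in> multisets_over A. sum_mset M = n} \<subseteq> fst ` overpartitions n"
  proof
    fix M assume M: "M \<in> {M \<in> multisets_over A. sum_mset M = n}"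
    then have "k > 0" if "k \<in># M" for k
      using that assms by (cases k) (auto simp: multisets_over_def)
    with M have "(M, {}) \<in> overpartitions n"
      by (simp add: overpartitions_def)
    then show "M \<in> fst ` overpartitions n"
      by (metis fst_conv image_eqI)
  qed
  then show "finite {M \<in> multisets_over A. sum_mset M = n}"
    using finite_overpartitions finite_surj by blast
qed

text \<open>A geometric series without division: a multiset either avoids \<open>k\<close> or arises
  by adding one \<open>k\<close>, so
  \<open>G = gen (multisets_over A) sum_mset + X ^ k * G\<close>.\<close>

lemma gen_multisets:
  assumes "finite A" "0 \<notin> A"
  shows "gen (multisets_over A) sum_mset * (\<Prod>k\<in>A. 1 - X ^ k) = 1"
  using assms
proof (induction A rule: finite_induct)
  case empty
  have "multisets_over {} = {{#}}"
    by (auto simp: multisets_over_def)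
  then show ?case
    by (simp add: gen_finite)
next
  case (insert k A)
  define G where "G = gen (multisets_over (insert k A)) sum_mset"
  have split: "multisets_over (insert k A) = multisets_over A \<union> add_mset k ` multisets_over (insert k A)"
  proof (intro equalityI subsetI)
    fix M assume M: "M \<in> multisets_over (insert k A)"
    show "M \<in> multisets_over A \<union> add_mset k ` multisets_over (insert k A)"
    proof (cases "k \<in># M")
      case True
      then have "M = add_mset k (M - {#k#})"
        by simp
      moreover have "M - {#k#} \<in> multisets_over (insert k A)"
        using M by (auto simp: multisets_over_def dest: in_diffD)
      ultimately show ?thesis by blast
    next
      case False
      with M show ?thesis by (auto simp: multisets_over_def)
    qed
  qed (auto simp: multisets_over_def)
  have "G = gen (multisets_over A) sum_mset + gen (add_mset k ` multisets_over (insert k A)) sum_mset"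
    unfolding G_def
  proof (subst split, rule gen_Un)
    show "finite_fibres (multisets_over A) sum_mset"
      using insert.prems by (intro finite_fibres_multisets) simp
    show "finite_fibres (add_mset k ` multisets_over (insert k A)) sum_mset"
      using finite_fibres_subset[OF finite_fibres_multisets[OF insert.prems]] split by blast
    show "multisets_over A \<inter> add_mset k ` multisets_over (insert k A) = {}"
      using insert.hyps by (auto simp: multisets_over_def)
  qed
  also have "gen (add_mset k ` multisets_over (insert k A)) sum_mset = X ^ k * G"
    unfolding G_def X_power_gen
    by (rule gen_bij[symmetric, OF inj_on_imp_bij_betw]) (auto simp: inj_on_def)
  finally have "G * (1 - X ^ k) = gen (multisets_over A) sum_mset"
    by (simp add: algebra_simps)
  then show ?case
    using insert by (simp add: mult.assoc[symmetric] flip: G_def)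
qed

lemma gen_Pow:
  assumes "finite A"
  shows "gen (Pow A) (\<Sum>) = (\<Prod>k\<in>A. 1 + X ^ k)"
  using assms
proof (induction A rule: finite_induct)
  case empty
  show ?case by (simp add: gen_finite)
next
  case (insert k A)
  have "gen (Pow (insert k A)) (\<Sum>) = gen (Pow A) (\<Sum>) + gen (insert k ` Pow A) (\<Sum>)"
    unfolding Pow_insert using insert.hyps
    by (intro gen_Un finite_fibres_finite) auto
  also have "gen (insert k ` Pow A) (\<Sum>) = X ^ k * gen (Pow A) (\<Sum>)"
    unfolding X_power_gen
  proof (rule gen_bij[symmetric, OF inj_on_imp_bij_betw])
    show "inj_on (insert k) (Pow A)"
      using insert.hyps by (auto simp: inj_on_def)
    show "\<Sum> (insert k S) = \<Sum> S + k" if "S \<in> Pow A" for S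
      using insert.hyps that by (subst sum.insert) (auto intro: finite_subset)
  qed
  finally show ?case
    using insert by (simp add: algebra_simps)
qed

definition R_series :: "nat \<Rightarrow> int fps" where
  "R_series l = Abs_fps (\<lambda>n. int (R_star l n))"

text \<open>An overpartition separates into the multiset of its non-overlined parts and the finite
  set of its overlined sizes; the two are independent, and adding the set back as a multiset inverts
  the separation.\<close>

lemma R_series_gen:
  "R_series l = gen (multisets_over {k. 0 < k \<and> \<not> l dvd k}) sum_mset *
    gen {S. finite S \<and> 0 \<notin> S} (\<Sum>)"
proof -
  let ?M = "multisets_over {k. 0 < k \<and> \<not> l dvd k}" and ?S = "{S :: nat set. finite S \<and> 0 \<notin> S}"
  have fS: "finite_fibres ?S (\<Sum>)"
    unfolding finite_fibres_def
  proof
    fix n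
    have "{S \<in> ?S. \<Sum> S = n} \<subseteq> Pow {..n}"
      by (auto intro: member_le_sum[of _ _ "\<lambda>k. k"])
    then show "finite {S \<in> ?S. \<Sum> S = n}"
      by (rule finite_subset) simp
  qed
  \<comment> \<open>The counted overpartitions of all \<open>n\<close> together, to be weighted by
    the sum of their parts.\<close>
  let ?P = "{P. \<exists>n. P \<in> overpartitions n \<and> (\<forall>k \<in># non_overlined_parts P. \<not> l dvd k)}"
  have split_parts: "non_overlined_parts P + mset_set (snd P) = fst P" if "P \<in> ?P" for P
  proof -
    have "snd P \<subseteq> set_mset (fst P)"
      using that by (auto simp: overpartitions_def)
    then have "mset_set (snd P) \<subseteq># fst P"
      by (meson finite_set_mset mset_set_set_mset_msubset subset_imp_msubset_mset_set
          subset_mset.order_trans)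
    then show ?thesis
      by (simp add: non_overlined_parts_def)
  qed
  have "R_series l = gen ?P (\<lambda>P. sum_mset (fst P))"
    unfolding R_series_def R_star_def fps_eq_iff gen_nth fps_nth_Abs_fps
    by (intro allI arg_cong[where f = int] arg_cong[where f = card]) (auto simp: overpartitions_def)
  also have "\<dots> = gen (?M \<times> ?S) (\<lambda>p. sum_mset (fst p) + \<Sum> (snd p))"
  proof (rule gen_bij)
    show "bij_betw (\<lambda>P. (non_overlined_parts P, snd P))
        ?P (?M \<times> ?S)" (is "bij_betw ?h _ _")
    proof (rule bij_betwI[where g = "\<lambda>(M, S). (M + mset_set S, S)"])
      show "?h \<in> ?P \<rightarrow> ?M \<times> ?S"
        by (auto simp: overpartitions_def multisets_over_def non_overlined_parts_def
            dest: in_diffD dest: finite_subset[OF _ finite_set_mset])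
      have inverse: "(M + mset_set S, S) \<in> ?P" if M: "M \<in> ?M" and S: "finite S" "0 \<notin> S" for M S
      proof -
        have "k > 0" if "k \<in> S" for k
          using that S(2) by (cases k) auto
        then have "(M + mset_set S, S) \<in> overpartitions (sum_mset (M + mset_set S))"
          using M S(1) unfolding overpartitions_def multisets_over_def by auto
        moreover have "non_overlined_parts (M + mset_set S, S) = M"
          by (simp add: non_overlined_parts_def)
        ultimately show ?thesis
          using M unfolding multisets_over_def by auto
      qed
      show "(\<lambda>(M, S). (M + mset_set S, S)) \<in> ?M \<times> ?S \<rightarrow> ?P"
      proof (rule Pi_I)
        fix p assume p: "p \<in> ?M \<times> ?S"
        obtain M S where MS: "p = (M, S)"
          by (cases p)
        show "(case p of (M, S) \<Rightarrow> (M + mset_set S, S)) \<in> ?P"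
          unfolding MS prod.case by (rule inverse) (use p MS in auto)
      qed
      show "(case ?h P of (M, S) \<Rightarrow> (M + mset_set S, S)) = P" if "P \<in> ?P" for P
        using split_parts[OF that] by simp
      show "?h ((\<lambda>(M, S). (M + mset_set S, S)) p) = p" if "p \<in> ?M \<times> ?S" for p
        by (cases p) (simp add: non_overlined_parts_def)
    qed
    show "sum_mset (fst (?h P)) + \<Sum> (snd (?h P)) = sum_mset (fst P)" if "P \<in> ?P" for P
    proof -
      have "sum_mset (fst P) = sum_mset (non_overlined_parts P + mset_set (snd P))"
        using split_parts[OF that] by simp
      then show ?thesis
        by (simp add: sum_unfold_sum_mset)
    qed
  qed
  also have "\<dots> = gen ?M sum_mset * gen ?S (\<Sum>)"
    by (intro gen_mult[symmetric] fS finite_fibres_multisets) simp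
  finally show ?thesis .
qed

text \<open>To order \<open>n\<close>, the overlined parts give \<open>D\<close>, which turns
  \<open>phi_neg\<close> into \<open>euler_prod n\<close>; the non-overlined parts cancel its
  factors with exponent not divisible by 8. What is left is \<open>f_8\<close>.\<close>

lemma R_series_phi_neg: "R_series 8 * phi_neg = dil (dil (dil euler))"
proof (rule eqmI)
  fix n
  define T :: "nat set" where "T = {k \<in> {1..n}. \<not> 8 dvd k}"
  define D where "D = (\<Prod>k=1..n. 1 + X ^ k)"
  have "eqm n (R_series 8) (gen (multisets_over T) sum_mset * gen (Pow {1..n}) (\<Sum>))"
    unfolding R_series_gen
  proof (intro eqm_mult gen_truncate)
    show "multisets_over T \<subseteq> multisets_over {k. 0 < k \<and> \<not> 8 dvd k}"
      by (auto simp: multisets_over_def T_def)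
    show "Pow {1..n} \<subseteq> {S. finite S \<and> 0 \<notin> S}"
      by (auto intro: finite_subset)
    fix M assume "M \<in> multisets_over {k. 0 < k \<and> \<not> 8 dvd k} - multisets_over T"
    then obtain k where "k \<in># M" "n < k"
      by (fastforce simp: multisets_over_def T_def)
    then show "n < sum_mset M"
      using sum_mset.remove[of k M] by simp
  next
    fix S assume "S \<in> {S. finite S \<and> 0 \<notin> S} - Pow {1..n}"
    then have "finite S" "0 \<notin> S" "\<not> S \<subseteq> {1..n}"
      by auto
    then obtain k where "k \<in> S" "k \<notin> {1..n}"
      by blast
    moreover from this \<open>0 \<notin> S\<close> have "n < k"
      by (cases k) auto
    ultimately show "n < \<Sum> S"
      using member_le_sum[of k S "\<lambda>k. k"] \<open>finite S\<close> by simp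
  qed
  then have F: "eqm n (R_series 8) (gen (multisets_over T) sum_mset * D)"
    by (simp add: gen_Pow D_def)
  have "D * (R_series 8 * phi_neg) = R_series 8 * (D * phi_neg)"
    by (simp only: mult_ac)
  also have "eqm n \<dots> ((gen (multisets_over T) sum_mset * D) * euler_prod n)"
    unfolding D_def by (intro eqm_mult F[unfolded D_def] phi_neg_product)
  also have "euler_prod n = (\<Prod>k\<in>T. 1 - X ^ k) * (\<Prod>k\<in>{1..n} - T. 1 - X ^ k)"
    unfolding euler_prod_def by (subst prod.subset_diff[of T]) (auto simp: T_def mult.commute)
  also have "(gen (multisets_over T) sum_mset * D) * \<dots> =
      D * (\<Prod>k\<in>{1..n} - T. 1 - X ^ k) * (gen (multisets_over T) sum_mset * (\<Prod>k\<in>T. 1 - X ^ k))"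
    by (simp only: mult_ac)
  also have "\<dots> = D * (\<Prod>k\<in>{1..n} - T. 1 - X ^ k)"
    by (subst gen_multisets) (auto simp: T_def)
  also have "eqm n \<dots> (D * dil (dil (dil euler)))"
  proof (intro eqm_mult eqm_refl)
    have "dil (dil (dil (euler_prod n))) = (\<Prod>k=1..n. 1 - X ^ (8 * k))"
      by (simp add: euler_prod_def dil_simps flip: power_mult)
    also have "\<dots> = (\<Prod>k\<in>(\<lambda>k. 8 * k) ` {1..n}. 1 - X ^ k)"
      by (subst prod.reindex) (auto simp: inj_on_def)
    finally have eq: "dil (dil (dil (euler_prod n))) = \<dots>" .
    \<comment> \<open>The multiples of 8 up to \<open>n\<close> lie among the exponents
      \<open>8 * k\<close>; the other factors are 1 to order \<open>n\<close>.\<close>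
    have "eqm n \<dots> (\<Prod>k\<in>{1..n} - T. 1 - X ^ k)"
      by (rule prod_truncate) (auto simp: T_def elim!: dvdE)
    then show "eqm n (\<Prod>k\<in>{1..n} - T. 1 - X ^ k) (dil (dil (dil euler)))"
      unfolding eq[symmetric]
      by (meson eqm_dil eqm_euler eqm_sym eqm_trans)
  qed
  finally have "eqm n (D * (R_series 8 * phi_neg)) (D * dil (dil (dil euler)))" .
  \<comment> \<open>Constant term 1 allows \<open>D\<close> to be cancelled at each order.\<close>
  moreover have "(\<Prod>k=1..m. 1 + X ^ k) $ 0 = 1" for m
    by (induction m) simp_all
  ultimately show "eqm n (R_series 8 * phi_neg) (dil (dil (dil euler)))"
    unfolding D_def by (rule eqm_cancel)
qed

section \<open>Iterated dissection\<close>

text \<open>The right side is grouped by parity in \<open>y\<close>: for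
  \<open>y = X * dil B\<close> even powers of \<open>y\<close> are dilations, so the groups become
  the even and odd parts of a series.\<close>

lemma expand_degree_7:
  fixes a y :: "'a::comm_ring_1"
  shows "(a + 8 * y) ^ 4 * (a + 24 * y) * (3 * (a + 24 * y) ^ 2 + 832 * y * (a + 8 * y)) =
    3 * a ^ 7 + 64 * y ^ 2 * (1039 * a ^ 5 + 325184 * a ^ 3 * y ^ 2 + 8474624 * a * y ^ 4)
    + 8 * y * (143 * a ^ 6 + 64 * y ^ 2 * (3179 * a ^ 4 + 286528 * a ^ 2 * y ^ 2 + 1609728 * y ^ 4))"
  by (simp add: algebra_simps power_numeral_reduce)

lemma expand_power_8:
  fixes a y :: "'a::comm_ring_1"
  shows "(a + 8 * y) ^ 8 = a ^ 8 + 64 * (y * (a ^ 7 + 28 * a ^ 6 * y + 448 * a ^ 5 * y ^ 2 +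
    4480 * a ^ 4 * y ^ 3 + 28672 * a ^ 3 * y ^ 4 + 114688 * a ^ 2 * y ^ 5 + 262144 * a * y ^ 6 +
    262144 * y ^ 7))"
  by (simp add: algebra_simps power_numeral_reduce)

text \<open>The linear coefficient 144 is split as \<open>16 + 2 * 64\<close>, which isolates the
  term that later produces \<open>1024 = 64 * 16\<close>.\<close>

lemma expand_power_6:
  fixes a y :: "'a::comm_ring_1"
  shows "(a + 24 * y) ^ 6 = a ^ 6 + 16 * a ^ 5 * y + 64 * (y * (2 * a ^ 5 + 135 * a ^ 4 * y +
    4320 * a ^ 3 * y ^ 2 + 77760 * a ^ 2 * y ^ 3 + 746496 * a * y ^ 4 + 2985984 * y ^ 5))"
  by (simp add: algebra_simps power_numeral_reduce)

text \<open>
  Here \<open>p\<close>, \<open>m\<close>, \<open>s\<close>, \<open>d\<close>, \<open>e\<close> and \<open>F\<close> stand for \<open>\<phi>(q)\<close>, \<open>\<phi>(-q)\<close>, \<open>\<psi>(q)\<close>, \<open>1/\<phi>(-q)\<close>, \<open>f_1\<close> and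
  \<open>f_8/\<phi>(-q)\<close>.  A name \<open>R8_5\<close> refers to the series of the coefficients of \<open>F\<close> at \<open>8n + 5\<close>.
\<close>
locale theta_relations =
  fixes p m s d e F :: "int fps"
  assumes p: "p = dil (dil p) + 2 * X * dil (dil (dil s))"
    and m: "m = dil (dil p) - 2 * X * dil (dil (dil s))"
    and p2: "p ^ 2 = dil (p ^ 2) + 4 * X * dil (dil (s ^ 2))"
    and ps: "p * dil s = s ^ 2"
    and md: "m * d = 1"
    and es: "e * s = dil (e ^ 2)"
    and e2: "e ^ 2 = dil e * m"
    and Fd: "F * m = dil (dil (dil e))"
begin

section \<open>Algebraic relations between the theta functions\<close>

text \<open>\<open>p\<close> and \<open>m\<close> are sum and difference of the same even and odd
  parts, so their squares differ by four times the product of these parts, which \<open>ps\<close>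
  simplifies.\<close>

lemma m2: "m ^ 2 = dil (p ^ 2) - 4 * X * dil (dil (s ^ 2))"
proof -
  have "m ^ 2 = p ^ 2 - 8 * X * dil (dil p) * dil (dil (dil s))"
    by (subst m, subst (2) p) (simp add: power2_eq_square algebra_simps)
  also have "\<dots> = dil (p ^ 2) + 4 * X * dil (dil (s ^ 2)) - 8 * X * dil (dil (p * dil s))"
    by (subst p2) (simp add: dil_mult)
  finally show ?thesis
    by (simp add: ps)
qed

text \<open>The product of sum and difference is a difference of squares, namely the dilation of
  \<open>m2\<close>.\<close>

lemma pm: "p * m = dil (m ^ 2)"
proof -
  have "p * m = dil (dil (p ^ 2)) - 4 * X ^ 2 * dil (dil (dil (s ^ 2)))"
    by (subst p, subst m) (simp add: power2_eq_square dil_simps algebra_simps)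
  also have "\<dots> = dil (m ^ 2)"
    by (subst m2) (simp add: dil_simps)
  finally show ?thesis .
qed

lemma d: "d = p * dil (d ^ 2)"
proof -
  have "d = d * dil ((m * d) ^ 2)"
    by (simp add: md dil_1)
  also have "\<dots> = d * dil (m ^ 2) * dil (d ^ 2)"
    by (simp add: dil_mult power_mult_distrib)
  also have "\<dots> = (m * d) * p * dil (d ^ 2)"
    by (simp add: pm[symmetric] mult_ac)
  finally show ?thesis by (simp add: md)
qed

lemma F: "F = dil (dil (dil e)) * d"
  by (metis Fd md mult.assoc mult.right_neutral)

text \<open>Chosen so that \<open>dil A\<close> and \<open>8 * X * dil B\<close> are the two parts
  of \<open>p ^ 4\<close>. By \<open>A_dil\<close> and \<open>X_B2\<close> the family is closed
  under dissection: \<open>A\<close> and \<open>X * B ^ 2\<close> are again polynomials in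
  \<open>dil A\<close> and \<open>X * dil B\<close>.\<close>

definition A where "A = p ^ 4 + 16 * X * dil (s ^ 4)"
definition B where "B = s ^ 4"

lemma B2: "B ^ 2 = p ^ 4 * dil B"
proof -
  have "B ^ 2 = (s ^ 2) ^ 4"
    by (simp add: B_def flip: power_mult)
  then show ?thesis
    by (simp add: B_def dil_power power_mult_distrib flip: ps)
qed

lemma p4: "p ^ 4 = dil A + 8 * X * dil B"
proof -
  have "p ^ 4 = (p ^ 2) ^ 2"
    by simp
  also have "\<dots> = (dil (p ^ 2) + 4 * X * dil (dil (s ^ 2))) ^ 2"
    by (rule arg_cong[OF p2])
  also have "\<dots> = dil (p ^ 4) + 16 * X ^ 2 * dil (dil (s ^ 4)) + 8 * X * dil ((p * dil s) ^ 2)"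
    by (simp add: dil_simps power_mult_distrib algebra_simps power2_eq_square power4_eq_xxxx)
  also have "\<dots> = dil A + 8 * X * dil B"
    by (simp add: ps A_def B_def dil_simps flip: power_mult)
  finally show ?thesis .
qed

section \<open>Powers that are even modulo 2, 4 and 8\<close>

lemma evenmod_p4: "evenmod 8 (p ^ 4)"
  by (subst p4) (rule evenmodI, simp add: mult.assoc)

lemma evenmod_p2: "evenmod 4 (p ^ 2)"
  by (subst p2) (rule evenmodI, simp add: mult.assoc)

lemma evenmod_p: "evenmod 2 p"
  by (subst p) (rule evenmodI, simp add: mult.assoc)

lemma evenmod_m: "evenmod 2 m"
  by (rule evenmodI[where b = "- X * dil (dil (dil s))"]) (subst m, simp add: mult.assoc)

lemma evenmod_m2: "evenmod 4 (m ^ 2)"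
  by (rule evenmodI[where b = "- X * dil (dil (s ^ 2))"]) (subst m2, simp add: mult.assoc)

lemma evenmod_m4: "evenmod 8 (m ^ 4)"
proof (rule evenmodI)
  have "m ^ 4 = (m ^ 2) ^ 2" by simp
  also have "\<dots> = dil (p ^ 4 + 16 * X * dil (s ^ 4)) + 8 * (- X * dil (p ^ 2 * dil (s ^ 2)))"
    by (subst m2) (simp add: dil_simps algebra_simps power2_eq_square power4_eq_xxxx)
  finally show "m ^ 4 = \<dots>" .
qed

text \<open>Here and in the next two facts a power of \<open>d\<close>, \<open>e\<close> or
  \<open>s\<close> is a power of \<open>p\<close> or \<open>m\<close> times a dilation, so it
  inherits the evenness of that theta power.\<close>

lemma d_power: "d ^ k = p ^ k * dil (d ^ (2 * k))"
  by (subst d) (simp add: power_mult_distrib dil_power power_mult)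

lemma e_power: "e ^ (2 * k) = dil (e ^ k) * m ^ k"
  by (simp add: power_mult e2 power_mult_distrib dil_power)

lemma s_power: "s ^ (2 * k) = p ^ k * dil (s ^ k)"
  by (simp add: power_mult ps[symmetric] power_mult_distrib dil_power)

lemma evenmod_2: "evenmod 2 (e ^ 2)" "evenmod 2 (s ^ 2)" "evenmod 2 d" "evenmod 2 A"
proof -
  have 24: "2 dvd (4 :: int fps)" and 28: "2 dvd (8 :: int fps)"
    by (rule dvdI[of _ _ 2] dvdI[of _ _ 4], simp)+
  show "evenmod 2 (e ^ 2)"
    using e_power[of 1] by (simp add: evenmod_mult evenmod_dil evenmod_m)
  show "evenmod 2 (s ^ 2)"
    using s_power[of 1] by (simp add: evenmod_mult evenmod_dil evenmod_p)
  show "evenmod 2 d"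
    by (subst d) (simp add: evenmod_mult evenmod_dil evenmod_p)
  have "16 * X * dil (s ^ 4) = 2 * (8 * X * dil (s ^ 4))"
    by simp
  then have "evenmod 2 (16 * X * dil (s ^ 4))"
    by (metis evenmod_const)
  then show "evenmod 2 A"
    unfolding A_def by (intro evenmod_add evenmod_dvd[OF 28 evenmod_p4])
qed

lemma evenmod_4: "evenmod 4 (e ^ 4)" "evenmod 4 B" "evenmod 4 (d ^ 2)"
  using e_power[of 2] s_power[of 2] d_power[of 2]
  by (simp_all add: B_def evenmod_mult evenmod_dil evenmod_p2 evenmod_m2)

lemma evenmod_8: "evenmod 8 (e ^ 8)" "evenmod 8 A" "evenmod 8 (d ^ 4)"
proof -
  show "evenmod 8 (e ^ 8)" "evenmod 8 (d ^ 4)"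
    using e_power[of 4] d_power[of 4] by (simp_all add: evenmod_mult evenmod_dil evenmod_p4 evenmod_m4)
  have "16 * X * dil (s ^ 4) = 8 * (2 * X * dil (s ^ 4))"
    by simp
  then have "evenmod 8 (16 * X * dil (s ^ 4))"
    by (metis evenmod_const)
  then show "evenmod 8 A"
    unfolding A_def by (intro evenmod_add evenmod_p4)
qed

section \<open>Successive dissections of the generating function\<close>

text \<open>Three uses of \<open>d\<close> give \<open>d = p * dil (p ^ 2) * dil (dil (p ^ 4)) * dil
  (dil (dil (d ^ 8)))\<close>. All factors of \<open>F\<close> but the first \<open>p\<close> are
  then even, and the odd part of \<open>F\<close> is governed by that of \<open>p\<close>.\<close>

lemma od_F: "od F = 2 * dil (dil (e * s * d ^ 8)) * p ^ 2 * dil (p ^ 4)"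
proof (rule od_dissect)
  define u where "u = dil (dil (dil e)) * dil (p ^ 2) * dil (dil (p ^ 4)) * dil (dil (dil (d ^ 8)))"
  have "F = p * u"
    unfolding u_def by (subst F) (use d d_power[of 2] d_power[of 4] in \<open>simp add: dil_mult mult_ac\<close>)
  also have "\<dots> = dil (dil p) * u + X * (2 * dil (dil (dil s)) * u)"
    by (subst p) (simp add: algebra_simps)
  also have "u = dil (dil (dil e) * p ^ 2 * dil (p ^ 4) * dil (dil (d ^ 8)))"
    by (simp add: u_def dil_mult)
  also have "2 * dil (dil (dil s)) * \<dots> =
      dil (2 * dil (dil (e * s * d ^ 8)) * p ^ 2 * dil (p ^ 4))"
    by (simp add: dil_mult dil_numeral mult_ac)
  finally show "F = dil (dil p * (dil (dil e) * p ^ 2 * dil (p ^ 4) * dil (dil (d ^ 8))))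
      + X * dil (2 * dil (dil (e * s * d ^ 8)) * p ^ 2 * dil (p ^ 4))"
    by (simp add: dil_mult)
qed

lemma od_F_split: "od F = dil (2 * dil (e * s * d ^ 8) * p ^ 6) + X * dil (8 * dil (e * s ^ 3 * d ^ 8) * p ^ 4)"
  unfolding od_F by (subst p2) (simp add: dil_simps algebra_simps power_numeral_reduce)

lemmas R4_1 = ev_dissect[OF od_F_split]
lemmas R4_3 = od_dissect[OF od_F_split]

text \<open>\<open>es\<close> makes the prefactor a dilation, so only \<open>p ^ 6\<close>, the cube
  of \<open>p2\<close>, is left to split.\<close>

lemma R4_1_split: "ev (od F) = dil (2 * dil (e ^ 2) * d ^ 8 * (p ^ 6 + 48 * X * p ^ 2 * dil B))
    + X * dil (8 * dil (e ^ 2 * s ^ 2) * d ^ 8 * (3 * p ^ 4 + 16 * X * dil B))"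
proof -
  have "ev (od F) = 2 * dil (dil (e ^ 2) * d ^ 8) * (p ^ 2) ^ 3"
    by (simp add: R4_1 es dil_mult flip: power_mult)
  also have "\<dots> = 2 * dil (dil (e ^ 2) * d ^ 8) * (dil (p ^ 2) + 4 * X * dil (dil (s ^ 2))) ^ 3"
    by (rule arg_cong[OF p2])
  finally show ?thesis
    by (simp add: B_def dil_simps algebra_simps power_numeral_reduce)
qed

lemma R4_3_split: "od (od F) = dil (8 * dil (e ^ 2) * s ^ 2 * d ^ 8 * A)
    + X * dil (64 * dil (e ^ 2) * s ^ 6 * d ^ 8)"
proof -
  have "od (od F) = 8 * dil ((e * s) * s ^ 2 * d ^ 8) * p ^ 4"
    by (simp add: R4_3 power_numeral_reduce mult_ac)
  then show ?thesis
    unfolding es p4 by (simp add: B_def dil_simps algebra_simps power_numeral_reduce)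
qed

lemmas R8_1 = ev_dissect[OF R4_1_split]
lemmas R8_5 = od_dissect[OF R4_1_split]
lemmas R8_3 = ev_dissect[OF R4_3_split]
lemmas R8_7 = od_dissect[OF R4_3_split]

lemma es2: "e ^ 2 * s ^ 2 = dil (e ^ 4)"
  using arg_cong[OF es, of "\<lambda>f. f ^ 2"] by (simp add: power_mult_distrib dil_power flip: power_mult)

lemma es4: "e ^ 4 * B = dil (e ^ 8)"
  using arg_cong[OF es, of "\<lambda>f. f ^ 4"] by (simp add: B_def power_mult_distrib dil_power flip: power_mult)

text \<open>Replacing \<open>d ^ 8\<close> by \<open>p ^ 8 * dil (d ^ 16)\<close> leaves a cubic
  polynomial in \<open>p ^ 4\<close>, which \<open>p4\<close> splits.\<close>

lemma R8_5_split: "od (ev (od F)) = dil (8 * dil (e ^ 4) * d ^ 16 * A * (3 * A ^ 2 + 832 * X * B ^ 2))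
    + X * dil (64 * dil (e ^ 4) * d ^ 16 * B * (11 * A ^ 2 + 320 * X * B ^ 2))"
proof -
  have "od (ev (od F)) = 8 * dil (dil (e ^ 4)) * dil (d ^ 16) *
      (3 * (dil A + 8 * X * dil B) ^ 3 + 16 * X * dil B * (dil A + 8 * X * dil B) ^ 2)"
    unfolding R8_5 d_power[of 8] es2 p4[symmetric]
    by (simp add: algebra_simps flip: power_add power_mult)
  then show ?thesis
    by (simp add: dil_simps algebra_simps power_numeral_reduce)
qed

lemmas R16_5 = ev_dissect[OF R8_5_split]
lemmas R16_13 = od_dissect[OF R8_5_split]

lemma A_dil: "A = dil A + 24 * (X * dil B)"
proof -
  have "A = p ^ 4 + 16 * X * dil B"
    by (simp add: A_def B_def)
  also have "\<dots> = dil A + 24 * (X * dil B)"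
    by (simp add: p4)
  finally show ?thesis .
qed

lemma X_B2: "X * B ^ 2 = X * dil B * (dil A + 8 * (X * dil B))"
  by (simp add: B2 p4 algebra_simps)

text \<open>Expressing \<open>p ^ 4\<close>, \<open>A\<close> and \<open>X * B ^ 2\<close> through
  \<open>dil A\<close> and \<open>y\<close> yields the polynomial of \<open>expand_degree_7\<close>.
  Only its leading terms are recorded; multiples of 64 go into \<open>U\<close> and
  \<open>W\<close>, and \<open>es4\<close> absorbs the \<open>B\<close> of the odd part.\<close>

lemma R16_5_split:
  obtains U W where "ev (od (ev (od F))) = dil (8 * e ^ 4 * d ^ 32 * (3 * A ^ 7 + 64 * U))
    + X * dil (64 * dil (e ^ 8) * d ^ 32 * (143 * A ^ 6 + 64 * W))"
proof
  define w where "w = X * B ^ 2"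
  define y where "y = X * dil B"
  let ?U = "w * (1039 * A ^ 5 + 325184 * A ^ 3 * w + 8474624 * A * w ^ 2)"
  let ?W = "w * (3179 * A ^ 4 + 286528 * A ^ 2 * w + 1609728 * w ^ 2)"
  have y2: "y ^ 2 = dil w"
    by (simp add: y_def w_def dil_simps power_mult_distrib)
  have "ev (od (ev (od F))) = 8 * dil (e ^ 4 * d ^ 32) * ((p ^ 4) ^ 4 * A * (3 * A ^ 2 + 832 * (X * B ^ 2)))"
    by (simp add: R16_5 d_power[of 16] dil_mult mult_ac flip: power_mult)
  also have "\<dots> = 8 * dil (e ^ 4 * d ^ 32) *
      ((dil A + 8 * y) ^ 4 * (dil A + 24 * y) * (3 * (dil A + 24 * y) ^ 2 + 832 * y * (dil A + 8 * y)))"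
    using A_dil by (simp add: p4 X_B2 mult.assoc flip: y_def)
  also have "\<dots> = 8 * dil (e ^ 4 * d ^ 32) * (dil (3 * A ^ 7 + 64 * ?U) + 8 * y * dil (143 * A ^ 6 + 64 * ?W))"
    unfolding expand_degree_7
    by (simp add: dil_simps power_mult flip: y2)
  also have "\<dots> = dil (8 * e ^ 4 * d ^ 32 * (3 * A ^ 7 + 64 * ?U)) +
      X * dil (64 * (e ^ 4 * B) * d ^ 32 * (143 * A ^ 6 + 64 * ?W))"
    by (simp add: y_def dil_simps algebra_simps)
  finally show "ev (od (ev (od F))) = dil (8 * e ^ 4 * d ^ 32 * (3 * A ^ 7 + 64 * ?U)) +
      X * dil (64 * dil (e ^ 8) * d ^ 32 * (143 * A ^ 6 + 64 * ?W))"
    unfolding es4 .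
qed

text \<open>Modulo 64, \<open>p ^ 32\<close> is \<open>a ^ 8\<close> and \<open>A ^ 6\<close> is
  \<open>a ^ 6 + 16 * a ^ 5 * y\<close>. The odd term thus has coefficient \<open>143 * 16\<close>,
  and with the prefactor 64 the whole odd part is a multiple of 1024.\<close>

lemma R32_21_split:
  obtains U W where "od (ev (od (ev (od F)))) = dil (64 * e ^ 8 * d ^ 64 * (143 * A ^ 14 + 64 * U))
    + X * dil (1024 * e ^ 8 * d ^ 64 * (143 * A ^ 13 * B + 4 * W))"
proof -
  obtain W where W: "od (ev (od (ev (od F)))) = 64 * dil (e ^ 8) * d ^ 32 * (143 * A ^ 6 + 64 * W)"
    using R16_5_split od_dissect by metis
  define a where "a = dil A"
  define y where "y = X * dil B"
  obtain k where k: "(a + 8 * y) ^ 8 = a ^ 8 + 64 * k"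
    using expand_power_8 by blast
  obtain l where l: "(a + 24 * y) ^ 6 = a ^ 6 + 16 * a ^ 5 * y + 64 * l"
    using expand_power_6 by blast
  have p32: "p ^ 32 = a ^ 8 + 64 * k"
  proof -
    have "p ^ 32 = (p ^ 4) ^ 8"
      by (simp flip: power_mult)
    then show ?thesis
      unfolding p4 k[symmetric] by (simp add: a_def y_def mult.assoc)
  qed
  have A6: "A ^ 6 = a ^ 6 + 16 * a ^ 5 * y + 64 * l"
    using A_dil l by (simp add: a_def y_def)
  \<comment> \<open>\<open>Z\<close> gathers everything multiplied by 64; it is split abstractly
    into \<open>ev Z\<close> and \<open>od Z\<close>.\<close>
  define Z where "Z = a ^ 8 * (143 * l + W) + k * (143 * A ^ 6 + 64 * W)"
  have "od (ev (od (ev (od F)))) = 64 * dil (e ^ 8 * d ^ 64) * ((a ^ 8 + 64 * k) * (143 * A ^ 6 + 64 * W))"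
    unfolding W d_power[of 32] p32 by (simp add: dil_mult mult_ac)
  also have "(a ^ 8 + 64 * k) * (143 * A ^ 6 + 64 * W) = 143 * a ^ 14 + 2288 * a ^ 13 * y + 64 * Z"
    unfolding Z_def A6 by (simp add: algebra_simps flip: power_add)
  also have "\<dots> = 143 * a ^ 14 + 2288 * a ^ 13 * y + 64 * (dil (ev Z) + X * dil (od Z))"
    by (simp flip: dissect)
  finally have "od (ev (od (ev (od F)))) = dil (64 * e ^ 8 * d ^ 64 * (143 * A ^ 14 + 64 * ev Z))
    + X * dil (1024 * e ^ 8 * d ^ 64 * (143 * A ^ 13 * B + 4 * od Z))"
    by (simp add: a_def y_def dil_simps algebra_simps)
  then show thesis by (rule that)
qed

lemma R16_9:
  obtains T where "od (ev (ev (od F))) = 8 * (e ^ 2 * d ^ 16 * A ^ 3 * dil (s ^ 2)) + 16 * od T"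
proof -
  define a where "a = dil A"
  define y where "y = X * dil B"
  \<comment> \<open>\<open>T\<close> collects the terms divisible by 16, leaving
    \<open>2 * a ^ 3 * p ^ 2\<close> up to a dilation, whose odd part gains 4 from
    \<open>p2\<close>.\<close>
  define T where "T = dil (e ^ 2 * d ^ 16) * (y * (3 * a ^ 2 + 24 * a * y + 64 * y ^ 2) * p ^ 2
      + 6 * y * p ^ 10)"
  have d8: "d ^ 8 = p ^ 8 * dil (d ^ 16)"
    using d_power[of 8] by simp
  have powers: "(p ^ 4) ^ 3 * p ^ 2 = p ^ 6 * p ^ 8" "p ^ 10 = p ^ 2 * p ^ 8"
    by (simp_all flip: power_add power_mult)
  have "ev (ev (od F)) = 2 * dil (e ^ 2 * d ^ 16) * ((p ^ 4) ^ 3 * p ^ 2 + 48 * y * p ^ 10)"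
    unfolding powers R8_1 d8 y_def dil_mult
    by (simp only: distrib_left distrib_right mult_ac)
  also have "(p ^ 4) ^ 3 = a ^ 3 + 8 * (y * (3 * a ^ 2 + 24 * a * y + 64 * y ^ 2))"
    unfolding p4 by (simp add: a_def y_def algebra_simps power_numeral_reduce)
  finally have "ev (ev (od F)) = 2 * dil (e ^ 2 * d ^ 16) * a ^ 3 * p ^ 2 + 16 * T"
    by (simp add: T_def algebra_simps)
  also have "\<dots> = 2 * dil (e ^ 2 * d ^ 16) * a ^ 3 * (dil (p ^ 2) + 4 * X * dil (dil (s ^ 2)))
      + 16 * (dil (ev T) + X * dil (od T))"
    using p2 dissect[of T] by presburger
  also have "\<dots> = dil (2 * e ^ 2 * d ^ 16 * A ^ 3 * p ^ 2 + 16 * ev T)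
      + X * dil (8 * (e ^ 2 * d ^ 16 * A ^ 3 * dil (s ^ 2)) + 16 * od T)"
    by (simp add: a_def dil_simps algebra_simps)
  finally show thesis
    using that od_dissect by blast
qed

section \<open>Reading off the congruences\<close>

lemma dvd_4_8: "4 dvd (8 :: int fps)"
  by (rule dvdI[of _ _ 2]) simp

lemmas evenmod_intros = evenmod_add evenmod_mult evenmod_power evenmod_dil evenmod_numeral

text \<open>The binary digits of the residue, lowest first, dictate the chain of \<open>od\<close>
  and \<open>ev\<close>, innermost first. The leading digit 1 asks for an odd coefficient of a
  series that is even modulo 4 apart from its factor 2. The next proofs follow the same
  scheme.\<close>

lemma dvd_16_9: "8 dvd F $ (16 * n + 9)"
proof -
  \<comment> \<open>The factors are regrouped into powers known to be even modulo 4, and 48 is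
    written as \<open>4 * 12\<close>.\<close>
  have eq: "ev (ev (od F)) = 2 * (dil (e ^ 2) * (d ^ 2) ^ 4 * ((p ^ 2) ^ 3 + 4 * (12 * X * p ^ 2 * dil B)))"
    by (simp add: R8_1 mult.assoc flip: power_mult)
  have "evenmod (2 * 4) (ev (ev (od F)))"
    unfolding eq by (intro evenmod_scale evenmod_intros evenmod_const evenmod_4 evenmod_p2)
  then have "8 dvd (ev (ev (od F))) $ (2 * n + 1)"
    by (intro evenmod_odd_nth) simp
  moreover have "16 * n + 9 = 2 * (2 * (2 * (2 * n + 1))) + 1"
    by simp
  ultimately show ?thesis
    by (simp only: ev_nth od_nth)
qed

lemma dvd_16_11: "16 dvd F $ (16 * n + 11)"
proof -
  have eq: "ev (od (od F)) = 8 * (dil (e ^ 2) * s ^ 2 * d ^ 8 * A)"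
    by (simp add: R8_3 mult.assoc)
  have "evenmod (8 * 2) (ev (od (od F)))"
    unfolding eq by (intro evenmod_scale evenmod_intros evenmod_2)
  then have "16 dvd (ev (od (od F))) $ (2 * n + 1)"
    by (intro evenmod_odd_nth) simp
  moreover have "16 * n + 11 = 2 * (2 * (2 * (2 * n + 1)) + 1) + 1"
    by simp
  ultimately show ?thesis
    by (simp only: ev_nth od_nth)
qed

lemma dvd_16_15: "128 dvd F $ (16 * n + 15)"
proof -
  have eq: "od (od (od F)) = 64 * (dil (e ^ 2) * (s ^ 2) ^ 3 * d ^ 8)"
    by (simp add: R8_7 mult.assoc flip: power_mult)
  have "evenmod (64 * 2) (od (od (od F)))"
    unfolding eq by (intro evenmod_scale evenmod_intros evenmod_2)
  then have "128 dvd (od (od (od F))) $ (2 * n + 1)"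
    by (intro evenmod_odd_nth) simp
  moreover have "16 * n + 15 = 2 * (2 * (2 * (2 * n + 1) + 1) + 1) + 1"
    by simp
  ultimately show ?thesis
    by (simp only: ev_nth od_nth)
qed

lemma dvd_32_25: "16 dvd F $ (32 * n + 25)"
proof -
  obtain T where R16_9: "od (ev (ev (od F))) = 8 * (e ^ 2 * d ^ 16 * A ^ 3 * dil (s ^ 2)) + 16 * od T"
    by (rule R16_9)
  have eq: "od (ev (ev (od F))) = 8 * (e ^ 2 * d ^ 16 * A ^ 3 * dil (s ^ 2) + 2 * od T)"
    unfolding R16_9 by simp
  have "evenmod (8 * 2) (od (ev (ev (od F))))"
    unfolding eq by (intro evenmod_scale evenmod_intros evenmod_2 evenmod_const)
  then have "16 dvd (od (ev (ev (od F)))) $ (2 * n + 1)"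
    by (intro evenmod_odd_nth) simp
  moreover have "32 * n + 25 = 2 * (2 * (2 * (2 * (2 * n + 1) + 1))) + 1"
    by simp
  ultimately show ?thesis
    by (simp only: ev_nth od_nth)
qed

lemma dvd_32_21: "64 dvd F $ (32 * n + 21)"
proof -
  \<comment> \<open>Here \<open>d ^ 16\<close> is a power of \<open>d ^ 4\<close> and 832 is
    \<open>8 * 104\<close>, so all factors are even modulo 8.\<close>
  have eq: "ev (od (ev (od F))) = 8 * (dil (e ^ 4) * (d ^ 4) ^ 4 * A * (3 * A ^ 2 + 8 * (104 * X * B ^ 2)))"
    by (simp add: R16_5 mult.assoc flip: power_mult)
  have "evenmod (8 * 8) (ev (od (ev (od F))))"
    unfolding eq by (intro evenmod_scale evenmod_intros evenmod_8 evenmod_const)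
  then have "64 dvd (ev (od (ev (od F)))) $ (2 * n + 1)"
    by (intro evenmod_odd_nth) simp
  moreover have "32 * n + 21 = 2 * (2 * (2 * (2 * (2 * n + 1)) + 1)) + 1"
    by simp
  ultimately show ?thesis
    by (simp only: ev_nth od_nth)
qed

lemma dvd_32_29: "256 dvd F $ (32 * n + 29)"
proof -
  have eq: "od (od (ev (od F))) = 64 * (dil (e ^ 4) * (d ^ 2) ^ 8 * B * (11 * A ^ 2 + 4 * (80 * X * B ^ 2)))"
    by (simp add: R16_13 mult.assoc flip: power_mult)
  have "evenmod (64 * 4) (od (od (ev (od F))))"
    unfolding eq by (intro evenmod_scale evenmod_intros evenmod_const evenmod_4 evenmod_dvd[OF dvd_4_8 evenmod_8(2)])
  then have "256 dvd (od (od (ev (od F)))) $ (2 * n + 1)"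
    by (intro evenmod_odd_nth) simp
  moreover have "32 * n + 29 = 2 * (2 * (2 * (2 * (2 * n + 1) + 1) + 1)) + 1"
    by simp
  ultimately show ?thesis
    by (simp only: ev_nth od_nth)
qed

lemma dvd_64_37: "32 dvd F $ (64 * n + 37)"
proof -
  obtain U W where split: "ev (od (ev (od F))) = dil (8 * e ^ 4 * d ^ 32 * (3 * A ^ 7 + 64 * U))
      + X * dil (64 * dil (e ^ 8) * d ^ 32 * (143 * A ^ 6 + 64 * W))"
    by (rule R16_5_split)
  have eq: "ev (ev (od (ev (od F)))) = 8 * (e ^ 4 * (d ^ 2) ^ 16 * (3 * A ^ 7 + 4 * (16 * U)))"
    using ev_dissect[OF split] by (simp add: mult.assoc flip: power_mult)
  have "evenmod (8 * 4) (ev (ev (od (ev (od F)))))"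
    unfolding eq by (intro evenmod_scale evenmod_intros evenmod_const evenmod_4 evenmod_dvd[OF dvd_4_8 evenmod_8(2)])
  then have "32 dvd (ev (ev (od (ev (od F))))) $ (2 * n + 1)"
    by (intro evenmod_odd_nth) simp
  moreover have "64 * n + 37 = 2 * (2 * (2 * (2 * (2 * (2 * n + 1))) + 1)) + 1"
    by simp
  ultimately show ?thesis
    by (simp only: ev_nth od_nth)
qed

lemma dvd_128_85: "512 dvd F $ (128 * n + 85)"
proof -
  obtain U W where split: "od (ev (od (ev (od F)))) = dil (64 * e ^ 8 * d ^ 64 * (143 * A ^ 14 + 64 * U))
      + X * dil (1024 * e ^ 8 * d ^ 64 * (143 * A ^ 13 * B + 4 * W))"
    by (rule R32_21_split)
  have eq: "ev (od (ev (od (ev (od F))))) = 64 * (e ^ 8 * (d ^ 4) ^ 16 * (143 * A ^ 14 + 8 * (8 * U)))"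
    using ev_dissect[OF split] by (simp add: mult.assoc flip: power_mult)
  have "evenmod (64 * 8) (ev (od (ev (od (ev (od F))))))"
    unfolding eq by (intro evenmod_scale evenmod_intros evenmod_const evenmod_8)
  then have "512 dvd (ev (od (ev (od (ev (od F)))))) $ (2 * n + 1)"
    by (intro evenmod_odd_nth) simp
  moreover have "128 * n + 85 = 2 * (2 * (2 * (2 * (2 * (2 * (2 * n + 1)) + 1)) + 1)) + 1"
    by simp
  ultimately show ?thesis
    by (simp only: ev_nth od_nth)
qed

text \<open>The factor 1024 gains 4, because \<open>B\<close> is even modulo 4 and the remainder
  \<open>W\<close> enters with a factor 4.\<close>

lemma dvd_128_117: "4096 dvd F $ (128 * n + 117)"
proof -
  obtain U W where split: "od (ev (od (ev (od F)))) = dil (64 * e ^ 8 * d ^ 64 * (143 * A ^ 14 + 64 * U))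
      + X * dil (1024 * e ^ 8 * d ^ 64 * (143 * A ^ 13 * B + 4 * W))"
    by (rule R32_21_split)
  have eq: "od (od (ev (od (ev (od F))))) = 1024 * ((e ^ 4) ^ 2 * (d ^ 2) ^ 32 * (143 * A ^ 13 * B + 4 * W))"
    using od_dissect[OF split] by (simp add: mult.assoc flip: power_mult)
  have "evenmod (1024 * 4) (od (od (ev (od (ev (od F))))))"
    unfolding eq by (intro evenmod_scale evenmod_intros evenmod_const evenmod_4 evenmod_dvd[OF dvd_4_8 evenmod_8(2)])
  then have "4096 dvd (od (od (ev (od (ev (od F)))))) $ (2 * n + 1)"
    by (intro evenmod_odd_nth) simp
  moreover have "128 * n + 117 = 2 * (2 * (2 * (2 * (2 * (2 * (2 * n + 1) + 1) + 1)) + 1)) + 1"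
    by simp
  ultimately show ?thesis
    by (simp only: ev_nth od_nth)
qed

text \<open>The whole series of coefficients at \<open>16 * n + 13\<close> has the explicit factor
  64, so evenness does not enter.\<close>

lemma dvd_16_13: "64 dvd F $ (16 * n + 13)"
proof -
  have "64 dvd (od (od (ev (od F)))) $ n"
    by (simp add: R16_13 numeral_fps_const mult.assoc)
  moreover have "16 * n + 13 = 2 * (2 * (2 * (2 * n + 1) + 1)) + 1"
    by simp
  ultimately show ?thesis
    by (simp only: ev_nth od_nth)
qed

lemma dvd_64_53: "1024 dvd F $ (64 * n + 53)"
proof -
  obtain U W where split: "od (ev (od (ev (od F)))) = dil (64 * e ^ 8 * d ^ 64 * (143 * A ^ 14 + 64 * U))
      + X * dil (1024 * e ^ 8 * d ^ 64 * (143 * A ^ 13 * B + 4 * W))"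
    by (rule R32_21_split)
  have "1024 dvd (od (od (ev (od (ev (od F)))))) $ n"
    unfolding od_dissect[OF split] by (simp add: numeral_fps_const mult.assoc)
  moreover have "64 * n + 53 = 2 * (2 * (2 * (2 * (2 * (2 * n + 1) + 1)) + 1)) + 1"
    by simp
  ultimately show ?thesis
    by (simp only: ev_nth od_nth)
qed

end

lemma R_series_cong:
  assumes "numeral c dvd R_series l $ n"
  shows "[R_star l n = 0] (mod numeral c)"
proof -
  have "int (numeral c) dvd int (R_star l n)"
    using assms by (simp add: R_series_def)
  then show ?thesis
    by (simp only: of_nat_dvd_iff cong_0_iff)
qed

theorem theorem1p6:
  fixes n :: nat
  shows "[R_star 8 (16 * n + 9) = 0] (mod 8)
    \<and> [R_star 8 (16 * n + 11) = 0] (mod 16)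
    \<and> [R_star 8 (32 * n + 25) = 0] (mod 16)
    \<and> [R_star 8 (64 * n + 37) = 0] (mod 32)
    \<and> [R_star 8 (16 * n + 13) = 0] (mod 64)
    \<and> [R_star 8 (32 * n + 21) = 0] (mod 64)
    \<and> [R_star 8 (16 * n + 15) = 0] (mod 128)
    \<and> [R_star 8 (32 * n + 29) = 0] (mod 256)
    \<and> [R_star 8 (128 * n + 85) = 0] (mod 512)
    \<and> [R_star 8 (64 * n + 53) = 0] (mod 1024)
    \<and> [R_star 8 (128 * n + 117) = 0] (mod 4096)"
proof -
  have "phi_neg $ 0 = 1"
    using phi_neg_truncate[of 0] by (simp add: eqm_def)
  then have inverse: "phi_neg * fps_right_inverse phi_neg 1 = 1"
    by (rule unit_inverse)
  \<comment> \<open>The abstract \<open>d\<close> becomes the inverse of \<open>phi_neg\<close>, and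
    \<open>F\<close> the overpartition series.\<close>
  interpret theta_relations phi phi_neg psi "fps_right_inverse phi_neg 1" euler "R_series 8"
    by (rule theta_relations.intro[OF phi_dissect phi_neg phi_square phi_psi inverse
          euler_psi euler_phi_neg R_series_phi_neg])
  show ?thesis
    by (intro conjI R_series_cong dvd_16_9 dvd_16_11 dvd_32_25 dvd_64_37 dvd_16_13 dvd_32_21
        dvd_16_15 dvd_32_29 dvd_128_85 dvd_64_53 dvd_128_117)
qed

end
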